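(* Let $\eta$ be a locally square integrable stationary point process on $\mathbb{R}^d$ with intensity $\gamma\in(0,\infty)$, let $p>0$, and assume that $\int (1+\|x\|^p)\,|\beta_2^!|(dx)<\infty$. Let $h\in\mathcal{H}_p$. Suppose that $(k_r),(\ell_r)\in\mathbf{F}\cup\{\mathbf{0}\}$, and set $k:=\lim_{r\to\infty}k_r$ and $\ell:=\lim_{r\to\infty}\ell_r$. If $k\neq\ell$, then $$\lim_{r\to\infty}\mathbb{E}\,\big[T_r(k_r)\overline{T_r(\ell_r)}\big]=0.$$ Furthermore, $$\lim_{r\to\infty}\mathbb{E}\,|T_r(k_r)|^2=\gamma\, M_2(h)\, S(k).$$
   Context: Let $d\ge 1$. A (simple) point process $\eta$ on $\mathbb{R}^d$ is a random locally finite subset of $\mathbb{R}^d$ (with the $\sigma$-field generated by the counts $\eta(B):=\mathrm{card}(\eta\cap B)$, $B$ Borel). It is stationary if the distribution of $\eta+x$ does not depend on $x\in\mathbb{R}^d$; its intensity is $\gamma:=\mathbb{E}\,\eta([0,1]^d)$. It is locally square integrable if $\mathbb{E}\,\eta(B)^2<\infty$ for each bounded Borel set $B$. The reduced second factorial moment measure is $\alpha_2^!(\cdot):=\mathbb{E}\sum_{x,y\in\eta,\,x\ne y}\mathbf{1}\{x\in[0,1]^d,\ y-x\in\cdot\}$, and $\beta_2^!:=\alpha_2^!-\gamma^2\lambda_d$ (a signed measure defined on bounded Borel sets), where $\lambda_d$ is Lebesgue measure. $|\beta_2^!|$ is its total variation measure (defined on each bounded Borel set and extended by consistency to a locally finite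 measure on $\mathbb{R}^d$). When $|\beta_2^!|(\mathbb{R}^d)<\infty$, the structure factor is $S(k):=1+\frac1\gamma\int e^{-i\langle k,x\rangle}\,\beta_2^!(dx)$, $k\in\mathbb{R}^d$. For $p>0$, $\mathcal{H}_p$ is the class of bounded measurable functions $h:\mathbb{R}^d\to[0,\infty)$ such that $\int h(x)\,dx<\infty$ and there exist constants $a,b>0$ with $\mathbf{1}\{\|y\|\le b\}\int|h(x+y)-h(x)|\,dx\le a\|y\|^p$ for all $y\in\mathbb{R}^d$. Put $M_j(h):=\int h(x)^j\,dx$ for $j=1,2$, and $h_r(x):=h(x/r)$ for $r>0$. $\mathbf{F}$ (depending on $h$) is the set of functions $r\mapsto k_r$ from $(0,\infty)$ to $\mathbb{R}^d$, written $(k_r)$, such that $\lim_{r\to\infty}k_r$ exists in $\mathbb{R}^d\setminus\{0\}$ and $\lim_{r\to\infty} r^{-d/2}\int h_r(x)e^{i\langle k_r,x\rangle}\,dx=\lim_{r\to\infty} r^{-d/2}\int h_r(x)e^{-i\langle k_r,x\rangle}\,dx=0$. $\mathbf{0}$ denotes the function $r\mapsto 0\in\mathbb{R}^d$. For $r>0$ and $k\in\mathbb{R}^d$, $$T_r(k):=\frac{1}{r^{d/2}}\sum_{x\in\eta}h_r(x)e^{-i\langle k,x\rangle}-\mathbf{1}\{k=0\}M_1(h)\gamma r^{d/2}.$$ *)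

theory Defs
  imports "HOL-Probability.Probability"
begin

definition locally_finite_set :: "'a::euclidean_space set \<Rightarrow> bool" where
  "locally_finite_set A \<longleftrightarrow> (\<forall>B. bounded B \<longrightarrow> finite (A \<inter> B))"

text \<open>The count \<open>card (A \<inter> B)\<close>, with value \<open>\<infinity>\<close> (rather than 0, as \<^const>\<open>card\<close> would give)
  if \<open>A \<inter> B\<close> is infinite.\<close>
definition npoints :: "'a set \<Rightarrow> 'a set \<Rightarrow> ennreal" where
  "npoints A B = emeasure (count_space UNIV) (A \<inter> B)"

definition config_space :: "'a::euclidean_space set measure" where
  "config_space = sigma {A. locally_finite_set A}
     {{A. locally_finite_set A \<and> npoints A B \<in> C} |B C. B \<in> sets borel \<and> C \<in> sets borel}"

definition point_process :: "'w measure \<Rightarrow> ('w \<Rightarrow> 'a::euclidean_space set) \<Rightarrow> bool" where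
  "point_process M \<eta> \<longleftrightarrow> prob_space M \<and> \<eta> \<in> M \<rightarrow>\<^sub>M config_space"

definition stationary :: "'w measure \<Rightarrow> ('w \<Rightarrow> 'a::euclidean_space set) \<Rightarrow> bool" where
  "stationary M \<eta> \<longleftrightarrow>
     (\<forall>x. distr M config_space (\<lambda>\<omega>. (+) x ` \<eta> \<omega>) = distr M config_space \<eta>)"

definition intensity :: "'w measure \<Rightarrow> ('w \<Rightarrow> 'a::euclidean_space set) \<Rightarrow> ennreal" where
  "intensity M \<eta> = (\<integral>\<^sup>+\<omega>. npoints (\<eta> \<omega>) (cbox 0 One) \<partial>M)"

definition locally_square_integrable ::
    "'w measure \<Rightarrow> ('w \<Rightarrow> 'a::euclidean_space set) \<Rightarrow> bool" where
  "locally_square_integrable M \<eta> \<longleftrightarrow>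
     (\<forall>B\<in>sets borel. bounded B \<longrightarrow> (\<integral>\<^sup>+\<omega>. (npoints (\<eta> \<omega>) B)\<^sup>2 \<partial>M) < \<infinity>)"

text \<open>The inner integral with respect to counting measure is the sum over the pairs of distinct
  points of \<open>\<eta>\<close>.\<close>
definition alpha2 :: "'w measure \<Rightarrow> ('w \<Rightarrow> 'a::euclidean_space set) \<Rightarrow> 'a set \<Rightarrow> ennreal" where
  "alpha2 M \<eta> B =
     (\<integral>\<^sup>+\<omega>. (\<integral>\<^sup>+(x, y). indicator (cbox 0 One) x * indicator B (y - x)
        \<partial>count_space {(x, y). x \<in> \<eta> \<omega> \<and> y \<in> \<eta> \<omega> \<and> x \<noteq> y}) \<partial>M)"

text \<open>Meaningful on bounded Borel sets only; all uses below evaluate it only there.\<close>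
definition beta2 :: "'w measure \<Rightarrow> ('w \<Rightarrow> 'a::euclidean_space set) \<Rightarrow> 'a set \<Rightarrow> real" where
  "beta2 M \<eta> B = enn2real (alpha2 M \<eta> B) - (enn2real (intensity M \<eta>))\<^sup>2 * measure lborel B"

text \<open>Jordan decomposition of a signed measure \<open>\<nu>\<close> that is defined on the bounded Borel sets:
  \<open>\<nu>\<^sup>+ A = sup {\<nu> E | E \<subseteq> A}\<close> and \<open>\<nu>\<^sup>- A = sup {- \<nu> E | E \<subseteq> A}\<close>. Restricting \<open>E\<close> to bounded Borel
  sets is no restriction for bounded \<open>A\<close>, and it gives the unique consistent extension to
  unbounded \<open>A\<close>. Negative values are mapped to 0 by \<^const>\<open>ennreal\<close>, which does not affect the
  supremum because \<open>E = {}\<close> is admitted.\<close>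
definition pos_variation :: "('a::euclidean_space set \<Rightarrow> real) \<Rightarrow> 'a measure" where
  "pos_variation \<nu> = measure_of UNIV (sets borel)
     (\<lambda>A. SUP E\<in>{E. E \<in> sets borel \<and> bounded E \<and> E \<subseteq> A}. ennreal (\<nu> E))"

definition neg_variation :: "('a::euclidean_space set \<Rightarrow> real) \<Rightarrow> 'a measure" where
  "neg_variation \<nu> = pos_variation (\<lambda>E. - \<nu> E)"

definition total_variation :: "('a::euclidean_space set \<Rightarrow> real) \<Rightarrow> 'a measure" where
  "total_variation \<nu> = measure_of UNIV (sets borel)
     (\<lambda>A. emeasure (pos_variation \<nu>) A + emeasure (neg_variation \<nu>) A)"

definition signed_integral ::
    "('a::euclidean_space set \<Rightarrow> real) \<Rightarrow> ('a \<Rightarrow> complex) \<Rightarrow> complex" where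
  "signed_integral \<nu> f = (\<integral>x. f x \<partial>pos_variation \<nu>) - (\<integral>x. f x \<partial>neg_variation \<nu>)"

definition structure_factor ::
    "'w measure \<Rightarrow> ('w \<Rightarrow> 'a::euclidean_space set) \<Rightarrow> 'a \<Rightarrow> complex" where
  "structure_factor M \<eta> k =
     1 + 1 / of_real (enn2real (intensity M \<eta>)) *
       signed_integral (beta2 M \<eta>) (\<lambda>x. exp (- \<i> * of_real (k \<bullet> x)))"

definition taper_class :: "real \<Rightarrow> ('a::euclidean_space \<Rightarrow> real) set" where
  "taper_class p = {h. h \<in> borel_measurable borel \<and> (\<forall>x. 0 \<le> h x) \<and> bounded (range h) \<and>
     integrable lborel h \<and>
     (\<exists>a>0. \<exists>b>0. \<forall>y. of_bool (norm y \<le> b) * (\<integral>x. \<bar>h (x + y) - h x\<bar> \<partial>lborel)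
        \<le> a * norm y powr p)}"

definition taper_moment :: "nat \<Rightarrow> ('a::euclidean_space \<Rightarrow> real) \<Rightarrow> real" where
  "taper_moment j h = (\<integral>x. h x ^ j \<partial>lborel)"

definition scaled :: "('a::euclidean_space \<Rightarrow> real) \<Rightarrow> real \<Rightarrow> 'a \<Rightarrow> real" where
  "scaled h r x = h (x /\<^sub>R r)"

text \<open>Functions on \<open>(0,\<infinity>)\<close> are represented by functions on \<^typ>\<open>real\<close> whose values outside
  \<open>(0,\<infinity>)\<close> are irrelevant.\<close>
definition wave_functions ::
    "('a::euclidean_space \<Rightarrow> real) \<Rightarrow> (real \<Rightarrow> 'a) set" where
  "wave_functions h = {\<kappa>. (\<exists>k. k \<noteq> 0 \<and> (\<kappa> \<longlongrightarrow> k) at_top) \<and>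
     ((\<lambda>r. of_real (r powr (- (real DIM('a) / 2))) *
        (\<integral>x. of_real (scaled h r x) * exp (\<i> * of_real (\<kappa> r \<bullet> x)) \<partial>lborel))
        \<longlongrightarrow> (0::complex)) at_top \<and>
     ((\<lambda>r. of_real (r powr (- (real DIM('a) / 2))) *
        (\<integral>x. of_real (scaled h r x) * exp (- \<i> * of_real (\<kappa> r \<bullet> x)) \<partial>lborel))
        \<longlongrightarrow> (0::complex)) at_top}"

definition zero_functions :: "(real \<Rightarrow> 'a::euclidean_space) set" where
  "zero_functions = {\<kappa>. \<forall>r>0. \<kappa> r = 0}"

text \<open>For integrable \<open>h\<close> the sum converges absolutely almost surely; where it does not
  converge, \<^const>\<open>infsum\<close> is 0.\<close>
definition scatter ::
    "'w measure \<Rightarrow> ('w \<Rightarrow> 'a::euclidean_space set) \<Rightarrow> ('a \<Rightarrow> real) \<Rightarrow> real \<Rightarrow> 'a \<Rightarrow> 'w \<Rightarrow> complex"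
  where
  "scatter M \<eta> h r k \<omega> =
     1 / of_real (r powr (real DIM('a) / 2)) *
       (\<Sum>\<^sub>\<infinity>x\<in>\<eta> \<omega>. of_real (scaled h r x) * exp (- \<i> * of_real (k \<bullet> x)))
     - of_bool (k = 0) *
       of_real (taper_moment 1 h * enn2real (intensity M \<eta>) * r powr (real DIM('a) / 2))"

end

(* Consider the mean of sums over pairs (x, y) of points of the process. In the coordinates
   (x, y - x) this mean measure is invariant under translations of x, so it is the product of
   Lebesgue measure and the reduced second moment measure gamma delta_0 + alpha_2^!. Hence, for
   bounded integrable f and g, the covariance of sum f and sum g over the process is
   gamma int f g + int (int f(x) g(x + z) dx) beta_2^!(dz).
   For the tapered exponentials, rescaling x turns the inner integral into
   exp(-i<k_r, z>) int h(u) h(u + z/r) exp(i <r(l_r - k_r), u>) du. This is bounded uniformly in r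
   and z, and |beta_2^!| is finite, so pointwise limits in z suffice. By L^1-continuity of h one may
   replace z/r by 0, and the rest is M_2(h) for k_r = l_r and tends to 0 by the Riemann-Lebesgue
   lemma for k <> l. The means of T_r(k_r) and T_r(l_r) vanish asymptotically, either by the
   centering or by the definition of F. *)
theory Submission
  imports Defs
begin


section \<open>Mean measures of kernels\<close>

text \<open>The delicate point is integrability: beta_2^! is a difference of two infinite measures,
  given on bounded sets only, whereas G(z) = int f(x) g(x + z) dx is spread over the whole space.
  Radon-Nikodym densities of alpha_2^! and gamma^2 lambda_d with respect to their sum make the
  Jordan parts explicit and show alpha_2^! <= gamma^2 lambda_d + (beta_2^!)^+. With |f| and |g| in
  place of f and g, the function G is Lebesgue integrable by Tonelli, and bounded, hence integrable
  for the finite measure (beta_2^!)^+. So it is integrable for alpha_2^!, and the signed integral is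
  a difference of two ordinary ones. Pairs with x = y stay in the mean measure. They produce the
  atom gamma delta_0, and a function supported on second coordinate 0 turns a sum over points into a
  sum over pairs, so first moments come from the same mean measure. Both limits of the correlations
  are controlled by the L^1 modulus of translation of h, with bounds that are explicit in the
  frequency.\<close>

locale measure_kernel =
  fixes M :: "'w measure" and N :: "'b measure" and K :: "'w \<Rightarrow> 'b measure"
  assumes sets_kernel: "\<omega> \<in> space M \<Longrightarrow> sets (K \<omega>) = sets N"
    and measurable_kernel [measurable]:
      "D \<in> sets N \<Longrightarrow> (\<lambda>\<omega>. emeasure (K \<omega>) D) \<in> borel_measurable M"
begin

text \<open>The intensity measure of the random measure \<open>K\<close>. That
  \<open>measure_of\<close> keeps the prescribed values is countable additivity, proved in
  \<open>emeasure_mean\<close>.\<close>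

definition mean :: "'b measure" where
  "mean = measure_of (space N) (sets N) (\<lambda>D. \<integral>\<^sup>+\<omega>. emeasure (K \<omega>) D \<partial>M)"

lemma sets_mean [measurable_cong, simp]: "sets mean = sets N"
  by (simp add: mean_def sets.space_closed)

lemma space_mean [simp]: "space mean = space N"
  using sets_mean by (rule sets_eq_imp_space_eq)

lemma emeasure_mean:
  assumes "D \<in> sets N"
  shows "emeasure mean D = (\<integral>\<^sup>+\<omega>. emeasure (K \<omega>) D \<partial>M)"
  unfolding mean_def
proof (rule emeasure_measure_of_sigma)
  show "sigma_algebra (space N) (sets N)"
    by (rule sets.sigma_algebra_axioms)
  show "positive (sets N) (\<lambda>D. \<integral>\<^sup>+\<omega>. emeasure (K \<omega>) D \<partial>M)"
    by (simp add: positive_def)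
  show "countably_additive (sets N) (\<lambda>D. \<integral>\<^sup>+\<omega>. emeasure (K \<omega>) D \<partial>M)"
  proof (rule countably_additiveI)
    fix D :: "nat \<Rightarrow> 'b set"
    assume D: "range D \<subseteq> sets N" "disjoint_family D"
    then have [measurable]: "\<And>i. D i \<in> sets N" by auto
    have "(\<Sum>i. \<integral>\<^sup>+\<omega>. emeasure (K \<omega>) (D i) \<partial>M) = (\<integral>\<^sup>+\<omega>. (\<Sum>i. emeasure (K \<omega>) (D i)) \<partial>M)"
      by (rule nn_integral_suminf [symmetric]) simp
    also have "\<dots> = (\<integral>\<^sup>+\<omega>. emeasure (K \<omega>) (\<Union>i. D i) \<partial>M)"
      using D by (intro nn_integral_cong suminf_emeasure) (auto simp: sets_kernel)
    finally show "(\<Sum>i. \<integral>\<^sup>+\<omega>. emeasure (K \<omega>) (D i) \<partial>M) = (\<integral>\<^sup>+\<omega>. emeasure (K \<omega>) (\<Union>i. D i) \<partial>M)" .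
  qed
qed (use assms in auto)

lemma borel_measurable_kernel:
  "f \<in> borel_measurable N \<Longrightarrow> \<omega> \<in> space M \<Longrightarrow> f \<in> borel_measurable (K \<omega>)"
  by (simp cong: measurable_cong_sets add: sets_kernel)

text \<open>Measurability and the formula share one induction on f: the additive and monotone steps
  exchange the outer integral with sums and suprema of inner integrals, which must already be known
  to be measurable in \<omega>.\<close>

lemma nn_integral_mean_aux:
  assumes f: "f \<in> borel_measurable N"
  shows "(\<lambda>\<omega>. \<integral>\<^sup>+x. f x \<partial>K \<omega>) \<in> borel_measurable M \<and>
    (\<integral>\<^sup>+x. f x \<partial>mean) = (\<integral>\<^sup>+\<omega>. \<integral>\<^sup>+x. f x \<partial>K \<omega> \<partial>M)"
  using f
proof (induction rule: borel_measurable_induct)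
  case (cong f g)
  have "(\<integral>\<^sup>+x. f x \<partial>K \<omega>) = (\<integral>\<^sup>+x. g x \<partial>K \<omega>)" if "\<omega> \<in> space M" for \<omega>
    using cong(3) sets_eq_imp_space_eq[OF sets_kernel[OF that]] by (intro nn_integral_cong) simp
  moreover have "(\<integral>\<^sup>+x. f x \<partial>mean) = (\<integral>\<^sup>+x. g x \<partial>mean)"
    using cong(3) by (intro nn_integral_cong) simp
  ultimately show ?case
    using cong(4) by (simp cong: measurable_cong nn_integral_cong)
next
  case (set A)
  have "(\<integral>\<^sup>+x. indicator A x \<partial>K \<omega>) = emeasure (K \<omega>) A" if "\<omega> \<in> space M" for \<omega>
    using set sets_kernel[OF that] by simp
  then show ?case
    using set by (simp add: emeasure_mean cong: measurable_cong nn_integral_cong)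
next
  case (mult u c)
  have "(\<integral>\<^sup>+x. c * u x \<partial>K \<omega>) = c * (\<integral>\<^sup>+x. u x \<partial>K \<omega>)" if "\<omega> \<in> space M" for \<omega>
    using mult by (intro nn_integral_cmult borel_measurable_kernel[OF _ that]) auto
  then show ?case
    using mult borel_measurable_times_ennreal[OF borel_measurable_const, of "\<lambda>\<omega>. \<integral>\<^sup>+x. u x \<partial>K \<omega>" M c]
    by (simp add: nn_integral_cmult cong: measurable_cong nn_integral_cong)
next
  case (add u v)
  have "(\<integral>\<^sup>+x. v x + u x \<partial>K \<omega>) = (\<integral>\<^sup>+x. v x \<partial>K \<omega>) + (\<integral>\<^sup>+x. u x \<partial>K \<omega>)" if "\<omega> \<in> space M" for \<omega>
    using add by (intro nn_integral_add borel_measurable_kernel[OF _ that]) auto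
  then show ?case
    using add borel_measurable_add[of "\<lambda>\<omega>. \<integral>\<^sup>+x. v x \<partial>K \<omega>" M "\<lambda>\<omega>. \<integral>\<^sup>+x. u x \<partial>K \<omega>"]
    by (simp add: nn_integral_add cong: measurable_cong nn_integral_cong)
next
  case (seq U)
  have eq: "(\<integral>\<^sup>+x. (SUP i. U i x) \<partial>K \<omega>) = (SUP i. \<integral>\<^sup>+x. U i x \<partial>K \<omega>)" if "\<omega> \<in> space M" for \<omega>
    using seq(3) borel_measurable_kernel[OF seq(1) that] by (intro nn_integral_monotone_convergence_SUP) auto
  have "(\<integral>\<^sup>+x. (SUP i. U i x) \<partial>mean) = (SUP i. \<integral>\<^sup>+x. U i x \<partial>mean)"
    using seq by (intro nn_integral_monotone_convergence_SUP) auto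
  also have "\<dots> = (SUP i. \<integral>\<^sup>+\<omega>. \<integral>\<^sup>+x. U i x \<partial>K \<omega> \<partial>M)"
    using seq by simp
  also have "\<dots> = (\<integral>\<^sup>+\<omega>. (SUP i. \<integral>\<^sup>+x. U i x \<partial>K \<omega>) \<partial>M)"
    using seq by (intro nn_integral_monotone_convergence_SUP[symmetric])
      (auto simp: incseq_def le_fun_def intro!: nn_integral_mono)
  finally have "(\<integral>\<^sup>+x. (SUP i. U i x) \<partial>mean) = (\<integral>\<^sup>+\<omega>. (SUP i. \<integral>\<^sup>+x. U i x \<partial>K \<omega>) \<partial>M)" .
  moreover have "(\<lambda>\<omega>. SUP i. \<integral>\<^sup>+x. U i x \<partial>K \<omega>) \<in> borel_measurable M"
    using seq by (intro borel_measurable_SUP) auto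
  ultimately show ?case
    using eq by (simp add: image_comp cong: measurable_cong nn_integral_cong)
qed

lemma measurable_nn_integral_kernel [measurable]:
  "f \<in> borel_measurable N \<Longrightarrow> (\<lambda>\<omega>. \<integral>\<^sup>+x. f x \<partial>K \<omega>) \<in> borel_measurable M"
  using nn_integral_mean_aux by blast

lemma nn_integral_mean:
  "f \<in> borel_measurable N \<Longrightarrow> (\<integral>\<^sup>+x. f x \<partial>mean) = (\<integral>\<^sup>+\<omega>. \<integral>\<^sup>+x. f x \<partial>K \<omega> \<partial>M)"
  using nn_integral_mean_aux by blast

lemma integrable_kernel_iff:
  fixes f :: "'b \<Rightarrow> 'c::{banach, second_countable_topology}"
  assumes "f \<in> borel_measurable N" "\<omega> \<in> space M"
  shows "integrable (K \<omega>) f \<longleftrightarrow> (\<integral>\<^sup>+x. norm (f x) \<partial>K \<omega>) < \<infinity>"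
  using borel_measurable_kernel[OF assms] by (simp add: integrable_iff_bounded)

text \<open>The Bochner integral is 0 by convention where f is not integrable, so it is a case
  distinction over the measurable event that the integral of the norm is finite.\<close>

lemma measurable_integral_kernel_real:
  fixes f :: "'b \<Rightarrow> real"
  assumes f [measurable]: "f \<in> borel_measurable N"
  shows "(\<lambda>\<omega>. \<integral>x. f x \<partial>K \<omega>) \<in> borel_measurable M"
proof -
  have "(\<integral>x. f x \<partial>K \<omega>) = (if (\<integral>\<^sup>+x. ennreal (norm (f x)) \<partial>K \<omega>) < \<infinity>
      then enn2real (\<integral>\<^sup>+x. f x \<partial>K \<omega>) - enn2real (\<integral>\<^sup>+x. ennreal (- f x) \<partial>K \<omega>) else 0)"
    if "\<omega> \<in> space M" for \<omega>
    using integrable_kernel_iff[OF f that]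
    by (simp add: real_lebesgue_integral_def not_integrable_integral_eq)
  moreover have "(\<lambda>\<omega>. if (\<integral>\<^sup>+x. ennreal (norm (f x)) \<partial>K \<omega>) < \<infinity>
      then enn2real (\<integral>\<^sup>+x. f x \<partial>K \<omega>) - enn2real (\<integral>\<^sup>+x. ennreal (- f x) \<partial>K \<omega>) else 0)
      \<in> borel_measurable M"
    by measurable
  ultimately show ?thesis
    by (simp cong: measurable_cong)
qed

lemma measurable_integral_kernel:
  fixes f :: "'b \<Rightarrow> complex"
  assumes f [measurable]: "f \<in> borel_measurable N"
  shows "(\<lambda>\<omega>. \<integral>x. f x \<partial>K \<omega>) \<in> borel_measurable M"
proof -
  note measurable_integral_kernel_real [measurable]
  have "(\<integral>x. f x \<partial>K \<omega>) = (if (\<integral>\<^sup>+x. ennreal (norm (f x)) \<partial>K \<omega>) < \<infinity>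
      then of_real (\<integral>x. Re (f x) \<partial>K \<omega>) + \<i> * of_real (\<integral>x. Im (f x) \<partial>K \<omega>) else 0)"
    if "\<omega> \<in> space M" for \<omega>
    using integrable_kernel_iff[OF f that]
    by (simp add: not_integrable_integral_eq complex_eq_iff)
  moreover have "(\<lambda>\<omega>. if (\<integral>\<^sup>+x. ennreal (norm (f x)) \<partial>K \<omega>) < \<infinity>
      then complex_of_real (\<integral>x. Re (f x) \<partial>K \<omega>) + \<i> * of_real (\<integral>x. Im (f x) \<partial>K \<omega>) else 0)
      \<in> borel_measurable M"
    by measurable
  ultimately show ?thesis
    by (simp cong: measurable_cong)
qed

lemma AE_integrable_kernel:
  fixes f :: "'b \<Rightarrow> 'c::{banach, second_countable_topology}"
  assumes "integrable mean f"
  shows "AE \<omega> in M. integrable (K \<omega>) f"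
proof -
  have [measurable]: "f \<in> borel_measurable N"
    using assms by (auto cong: measurable_cong_sets)
  have "(\<integral>\<^sup>+\<omega>. \<integral>\<^sup>+x. norm (f x) \<partial>K \<omega> \<partial>M) \<noteq> \<infinity>"
    using assms by (simp add: integrable_iff_bounded nn_integral_mean)
  then have "AE \<omega> in M. (\<integral>\<^sup>+x. norm (f x) \<partial>K \<omega>) \<noteq> \<infinity>"
    by (intro nn_integral_noteq_infinite) measurable
  then show ?thesis
    using AE_space by eventually_elim (auto simp: integrable_kernel_iff less_top)
qed

lemma integral_mean_nonneg:
  fixes f :: "'b \<Rightarrow> real"
  assumes f: "integrable mean f" and nonneg: "\<And>x. 0 \<le> f x"
  shows "integrable M (\<lambda>\<omega>. \<integral>x. f x \<partial>K \<omega>)" "(\<integral>x. f x \<partial>mean) = (\<integral>\<omega>. \<integral>x. f x \<partial>K \<omega> \<partial>M)"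
proof -
  have [measurable]: "f \<in> borel_measurable N"
    using f by (auto cong: measurable_cong_sets)
  note measurable_integral_kernel_real [measurable]
  have AE: "AE \<omega> in M. ennreal (\<integral>x. f x \<partial>K \<omega>) = (\<integral>\<^sup>+x. f x \<partial>K \<omega>)"
    using AE_integrable_kernel[OF f]
    by eventually_elim (simp add: nn_integral_eq_integral nonneg)
  have "ennreal (\<integral>x. f x \<partial>mean) = (\<integral>\<^sup>+x. f x \<partial>mean)"
    using f by (simp add: nn_integral_eq_integral nonneg)
  also have "\<dots> = (\<integral>\<^sup>+\<omega>. \<integral>\<^sup>+x. f x \<partial>K \<omega> \<partial>M)"
    by (rule nn_integral_mean) measurable
  also have "\<dots> = (\<integral>\<^sup>+\<omega>. ennreal (\<integral>x. f x \<partial>K \<omega>) \<partial>M)"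
    by (rule nn_integral_cong_AE) (use AE in auto)
  finally have eq: "(\<integral>\<^sup>+\<omega>. ennreal (\<integral>x. f x \<partial>K \<omega>) \<partial>M) = ennreal (\<integral>x. f x \<partial>mean)" ..
  have nn: "0 \<le> (\<integral>x. f x \<partial>K \<omega>)" for \<omega>
    using nonneg by (simp add: integral_nonneg)
  show int: "integrable M (\<lambda>\<omega>. \<integral>x. f x \<partial>K \<omega>)"
    using eq nn by (intro integrableI_nonneg) auto
  show "(\<integral>x. f x \<partial>mean) = (\<integral>\<omega>. \<integral>x. f x \<partial>K \<omega> \<partial>M)"
    using eq nonneg nn by (simp add: nn_integral_eq_integral[OF int] integral_nonneg)
qed

text \<open>Positive and negative parts reduce this to the nonnegative case. The inner integral is
  additive only where both parts are integrable, so the inner identity is an almost sure one and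
  measurability of the left side has to be supplied separately.\<close>

lemma integral_mean_real:
  fixes f :: "'b \<Rightarrow> real"
  assumes f: "integrable mean f"
  shows "integrable M (\<lambda>\<omega>. \<integral>x. f x \<partial>K \<omega>)" "(\<integral>x. f x \<partial>mean) = (\<integral>\<omega>. \<integral>x. f x \<partial>K \<omega> \<partial>M)"
proof -
  have [measurable]: "f \<in> borel_measurable N"
    using f by (auto cong: measurable_cong_sets)
  note measurable_integral_kernel_real [measurable]
  define f\<^sub>p f\<^sub>n where "f\<^sub>p = (\<lambda>x. max (f x) 0)" and "f\<^sub>n = (\<lambda>x. max (- f x) 0)"
  have nonneg: "0 \<le> f\<^sub>p x" "0 \<le> f\<^sub>n x" for x
    by (simp_all add: f\<^sub>p_def f\<^sub>n_def)
  have pn: "integrable mean f\<^sub>p" "integrable mean f\<^sub>n"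
    using f by (auto simp: f\<^sub>p_def f\<^sub>n_def)
  have f_eq: "f = (\<lambda>x. f\<^sub>p x - f\<^sub>n x)"
    by (auto simp: f\<^sub>p_def f\<^sub>n_def fun_eq_iff)
  have AE: "AE \<omega> in M. (\<integral>x. f\<^sub>p x \<partial>K \<omega>) - (\<integral>x. f\<^sub>n x \<partial>K \<omega>) = (\<integral>x. f x \<partial>K \<omega>)"
    using AE_integrable_kernel[OF pn(1)] AE_integrable_kernel[OF pn(2)]
    by eventually_elim (simp add: f_eq)
  have int: "integrable M (\<lambda>\<omega>. (\<integral>x. f\<^sub>p x \<partial>K \<omega>) - (\<integral>x. f\<^sub>n x \<partial>K \<omega>))"
    by (intro Bochner_Integration.integrable_diff integral_mean_nonneg pn nonneg)
  show "integrable M (\<lambda>\<omega>. \<integral>x. f x \<partial>K \<omega>)"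
    by (rule integrable_cong_AE_imp[OF int]) (use AE in \<open>auto simp: eq_commute\<close>)
  have "(\<integral>x. f x \<partial>mean) = (\<integral>x. f\<^sub>p x \<partial>mean) - (\<integral>x. f\<^sub>n x \<partial>mean)"
    unfolding f_eq by (rule Bochner_Integration.integral_diff[OF pn])
  also have "\<dots> = (\<integral>\<omega>. (\<integral>x. f\<^sub>p x \<partial>K \<omega>) - (\<integral>x. f\<^sub>n x \<partial>K \<omega>) \<partial>M)"
    by (simp only: integral_mean_nonneg[OF pn(1) nonneg(1)] integral_mean_nonneg[OF pn(2) nonneg(2)]
        Bochner_Integration.integral_diff)
  also have "\<dots> = (\<integral>\<omega>. \<integral>x. f x \<partial>K \<omega> \<partial>M)"
    by (rule integral_cong_AE) (use AE int in auto)
  finally show "(\<integral>x. f x \<partial>mean) = (\<integral>\<omega>. \<integral>x. f x \<partial>K \<omega> \<partial>M)" .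
qed

lemma integral_mean:
  fixes f :: "'b \<Rightarrow> complex"
  assumes f: "integrable mean f"
  shows "integrable M (\<lambda>\<omega>. \<integral>x. f x \<partial>K \<omega>)" "(\<integral>x. f x \<partial>mean) = (\<integral>\<omega>. \<integral>x. f x \<partial>K \<omega> \<partial>M)"
proof -
  have [measurable]: "f \<in> borel_measurable N"
    using f by (auto cong: measurable_cong_sets)
  note measurable_integral_kernel [measurable] measurable_integral_kernel_real [measurable]
  have ri: "integrable mean (\<lambda>x. Re (f x))" "integrable mean (\<lambda>x. Im (f x))"
    using f by auto
  let ?g = "\<lambda>\<omega>. complex_of_real (\<integral>x. Re (f x) \<partial>K \<omega>) + \<i> * of_real (\<integral>x. Im (f x) \<partial>K \<omega>)"
  have AE: "AE \<omega> in M. ?g \<omega> = (\<integral>x. f x \<partial>K \<omega>)"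
    using AE_integrable_kernel[OF f] by eventually_elim (simp add: complex_eq_iff)
  have int: "integrable M ?g"
    by (intro Bochner_Integration.integrable_add integrable_mult_right integrable_of_real
        integral_mean_real ri)
  show int': "integrable M (\<lambda>\<omega>. \<integral>x. f x \<partial>K \<omega>)"
    by (rule integrable_cong_AE_imp[OF int]) (use AE in \<open>auto simp: eq_commute\<close>)
  have "(\<integral>x. f x \<partial>mean) = (\<integral>\<omega>. ?g \<omega> \<partial>M)"
    using f int ri by (simp add: complex_eq_iff integral_mean_real flip: integral_Re integral_Im)
  also have "\<dots> = (\<integral>\<omega>. \<integral>x. f x \<partial>K \<omega> \<partial>M)"
    by (rule integral_cong_AE) (use AE in auto)
  finally show "(\<integral>x. f x \<partial>mean) = (\<integral>\<omega>. \<integral>x. f x \<partial>K \<omega> \<partial>M)" .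
qed

end


section \<open>Jordan decompositions on the bounded Borel sets\<close>

text \<open>The abstract shape of beta_2^!: a difference of two locally finite measures, possibly
  both of infinite mass, so that \<nu> makes sense on bounded sets only. The measures \<alpha> and
  \<beta> may overlap; they are not the Jordan parts.\<close>

locale signed_local_measure =
  fixes \<alpha> \<beta> :: "'a::euclidean_space measure" and \<nu> :: "'a set \<Rightarrow> real"
  assumes sets_alpha [measurable_cong, simp]: "sets \<alpha> = sets borel"
    and sets_beta [measurable_cong, simp]: "sets \<beta> = sets borel"
    and finite_alpha: "bounded B \<Longrightarrow> B \<in> sets borel \<Longrightarrow> emeasure \<alpha> B < \<infinity>"
    and finite_beta: "bounded B \<Longrightarrow> B \<in> sets borel \<Longrightarrow> emeasure \<beta> B < \<infinity>"
    and nu_eq: "bounded B \<Longrightarrow> B \<in> sets borel \<Longrightarrow> \<nu> B = measure \<alpha> B - measure \<beta> B"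
begin

text \<open>Exchanging the two measures turns each fact about \<open>pos_variation\<close> into one
  about \<open>neg_variation\<close>.\<close>

lemma swap: "signed_local_measure \<beta> \<alpha> (\<lambda>B. - \<nu> B)"
  by standard (use finite_alpha finite_beta in \<open>auto simp: nu_eq\<close>)

text \<open>Both measures are dominated by their sum s, which is sigma-finite because balls have
  finite mass. A common reference measure reduces the Jordan decomposition to the sign of f -
  g.\<close>

lemma densities:
  obtains s :: "'a measure" and f g :: "'a \<Rightarrow> real"
  where "sets s = sets borel" "f \<in> borel_measurable borel" "g \<in> borel_measurable borel"
    "\<And>x. 0 \<le> f x" "\<And>x. 0 \<le> g x" "\<alpha> = density s (\<lambda>x. ennreal (f x))" "\<beta> = density s (\<lambda>x. ennreal (g x))"
proof -
  define s where "s = measure_of UNIV (sets borel) (\<lambda>B. emeasure \<alpha> B + emeasure \<beta> B)"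
  have sets_s [measurable_cong, simp]: "sets s = sets borel"
    by (simp add: s_def sigma_algebra.sets_measure_of_eq[OF sets.sigma_algebra_axioms[of borel, simplified]])
  have s: "emeasure s B = emeasure \<alpha> B + emeasure \<beta> B" if "B \<in> sets borel" for B
    unfolding s_def
  proof (rule emeasure_measure_of_sigma)
    show "sigma_algebra UNIV (sets (borel :: 'a measure))"
      using sets.sigma_algebra_axioms[of "borel :: 'a measure"] by simp
    show "positive (sets borel) (\<lambda>B. emeasure \<alpha> B + emeasure \<beta> B)"
      by (simp add: positive_def)
    show "countably_additive (sets borel) (\<lambda>B. emeasure \<alpha> B + emeasure \<beta> B)"
      by (intro countably_additiveI) (simp add: suminf_add[symmetric] suminf_emeasure)
  qed fact
  let ?B = "\<lambda>n::nat. ball (0::'a) (real n)"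
  have cover: "(\<Union>n. ?B n) = (UNIV :: 'a set)"
    using reals_Archimedean2 by (auto simp: dist_norm)
  have sf: "sigma_finite_measure m"
    if "sets m = sets borel" "\<And>n. emeasure m (?B n) < \<infinity>" for m :: "'a measure"
  proof
    show "\<exists>A. countable A \<and> A \<subseteq> sets m \<and> \<Union>A = space m \<and> (\<forall>a\<in>A. emeasure m a \<noteq> \<infinity>)"
      using that cover sets_eq_imp_space_eq[OF that(1)]
      by (intro exI[of _ "range ?B"]) (auto simp: less_top)
  qed
  interpret s: sigma_finite_measure s
    by (rule sf) (auto simp: s finite_alpha[simplified] finite_beta[simplified])
  have sf_ab: "sigma_finite_measure \<alpha>" "sigma_finite_measure \<beta>"
    by (auto intro!: sf finite_alpha finite_beta)
  have ex: "\<exists>f. f \<in> borel_measurable borel \<and> (\<forall>x. 0 \<le> f x) \<and> m = density s (\<lambda>x. ennreal (f x))"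
    if m: "sets m = sets borel" "sigma_finite_measure m" "\<And>B. B \<in> sets borel \<Longrightarrow> emeasure m B \<le> emeasure s B" for m
  proof -
    have "absolutely_continuous s m"
      using m(1,3) by (force simp: absolutely_continuous_def null_sets_def)
    then obtain f where f: "f \<in> borel_measurable s" "density s f = m"
      using s.Radon_Nikodym m(1) sets_s by metis
    \<comment> \<open>Sigma-finiteness of m makes the density finite almost everywhere. Real-valued
      densities keep the difference f - g free of infinity minus infinity.\<close>
    then have "AE x in s. f x \<noteq> \<infinity>"
      using s.sigma_finite_iff_density_finite m(2) by blast
    then have "AE x in s. f x = ennreal (enn2real (f x))"
      by eventually_elim (auto simp: less_top)
    moreover have [measurable]: "f \<in> borel_measurable borel"
      using f(1) by (simp cong: measurable_cong_sets)
    ultimately have "density s f = density s (\<lambda>x. ennreal (enn2real (f x)))"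
      by (intro density_cong) auto
    with f(2) show ?thesis
      by (intro exI[of _ "\<lambda>x. enn2real (f x)"]) auto
  qed
  obtain f where "f \<in> borel_measurable borel" "\<forall>x. 0 \<le> f x" "\<alpha> = density s (\<lambda>x. ennreal (f x))"
    using ex[OF sets_alpha sf_ab(1)] by (auto simp: s)
  moreover obtain g where "g \<in> borel_measurable borel" "\<forall>x. 0 \<le> g x" "\<beta> = density s (\<lambda>x. ennreal (g x))"
    using ex[OF sets_beta sf_ab(2)] by (auto simp: s)
  ultimately show ?thesis
    using sets_s by (intro that) auto
qed

text \<open>The supremum is approached along the bounded parts of the positive set of the Hahn
  decomposition.\<close>
lemma pos_variation_eq_density:
  assumes s [measurable_cong, simp]: "sets s = sets borel"
    and [measurable]: "f \<in> borel_measurable borel" "g \<in> borel_measurable borel"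
    and nonneg: "\<And>x. 0 \<le> f x" "\<And>x. 0 \<le> g x"
    and \<alpha>: "\<alpha> = density s (\<lambda>x. ennreal (f x))" and \<beta>: "\<beta> = density s (\<lambda>x. ennreal (g x))"
  shows "pos_variation \<nu> = density s (\<lambda>x. ennreal (f x - g x))"
proof -
  let ?P = "density s (\<lambda>x. ennreal (f x - g x))"
  have sp [simp]: "space s = UNIV"
    using sets_eq_imp_space_eq[OF s] by simp
  have em: "emeasure \<alpha> E = (\<integral>\<^sup>+x. ennreal (f x) * indicator E x \<partial>s)"
       "emeasure \<beta> E = (\<integral>\<^sup>+x. ennreal (g x) * indicator E x \<partial>s)"
       "emeasure ?P E = (\<integral>\<^sup>+x. ennreal (f x - g x) * indicator E x \<partial>s)"
    if "E \<in> sets borel" for E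
    using that by (auto simp: \<alpha> \<beta> emeasure_density)
  have em_real: "emeasure \<alpha> E = ennreal (measure \<alpha> E)" "emeasure \<beta> E = ennreal (measure \<beta> E)"
    if "E \<in> sets borel" "bounded E" for E
    using finite_alpha[OF that(2,1)] finite_beta[OF that(2,1)] by (auto simp: emeasure_eq_ennreal_measure)
  have le: "ennreal (\<nu> E) \<le> emeasure ?P E" if E: "E \<in> sets borel" "bounded E" for E
  proof -
    have [measurable]: "E \<in> sets borel" by fact
    \<comment> \<open>Since \<open>ennreal\<close> sends negative numbers to 0,
      \<open>ennreal (f x - g x)\<close> is the positive part of f - g.\<close>
    have pointwise: "ennreal (f x) \<le> ennreal (f x - g x) + ennreal (g x)" for x
      using nonneg[of x] by (cases "g x \<le> f x") (auto simp: ennreal_neg ennreal_leI simp flip: ennreal_plus)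
    have "emeasure \<alpha> E \<le> (\<integral>\<^sup>+x. ennreal (f x - g x) * indicator E x + ennreal (g x) * indicator E x \<partial>s)"
      unfolding em(1)[OF E(1)] using pointwise
      by (intro nn_integral_mono) (auto simp: indicator_def)
    also have "\<dots> = emeasure ?P E + emeasure \<beta> E"
      unfolding em[OF E(1)] by (rule nn_integral_add) measurable
    finally have "ennreal (measure \<alpha> E) \<le> emeasure ?P E + ennreal (measure \<beta> E)"
      by (simp add: em_real E)
    then show ?thesis
      by (simp add: nu_eq E ennreal_minus[symmetric] ennreal_minus_le_iff add.commute)
  qed
  have ge: "emeasure ?P A \<le> (SUP E\<in>{E. E \<in> sets borel \<and> bounded E \<and> E \<subseteq> A}. ennreal (\<nu> E))"
    if A: "A \<in> sets borel" for A
  proof -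
    define E where "E n = A \<inter> {x. g x < f x} \<inter> ball 0 (real n)" for n
    have [measurable]: "A \<in> sets borel" by fact
    have E [measurable]: "E n \<in> sets borel" and bE: "bounded (E n)" for n
      unfolding E_def by (measurable, auto intro: bounded_subset[OF bounded_ball])
    have sub: "E n \<subseteq> A" for n
      by (auto simp: E_def)
    have inc: "incseq E"
      by (auto simp: incseq_def E_def)
    have union: "(\<Union>n. E n) = A \<inter> {x. g x < f x}"
      using reals_Archimedean2 by (auto simp: E_def dist_norm)
    have eq: "emeasure ?P (E n) = ennreal (\<nu> (E n))" for n
    proof -
      have "emeasure ?P (E n) + emeasure \<beta> (E n) =
          (\<integral>\<^sup>+x. ennreal (f x - g x) * indicator (E n) x + ennreal (g x) * indicator (E n) x \<partial>s)"
        unfolding em[OF E] by (rule nn_integral_add [symmetric]) measurable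
      also have "\<dots> = emeasure \<alpha> (E n)"
        unfolding em(1)[OF E] using nonneg
        by (intro nn_integral_cong) (auto simp: E_def indicator_def simp flip: ennreal_plus)
      finally have "emeasure ?P (E n) + ennreal (measure \<beta> (E n)) = ennreal (measure \<alpha> (E n))"
        by (simp add: em_real[OF E bE])
      then have "emeasure ?P (E n) = ennreal (measure \<alpha> (E n)) - ennreal (measure \<beta> (E n))"
        by (metis ennreal_add_diff_cancel_right ennreal_neq_top)
      then show ?thesis
        by (simp add: nu_eq[OF bE E] ennreal_minus)
    qed
    have "emeasure ?P A = (\<integral>\<^sup>+x. ennreal (f x - g x) * indicator (\<Union>n. E n) x \<partial>s)"
      unfolding em(3)[OF A] union
      by (intro nn_integral_cong) (auto simp: indicator_def ennreal_neg)
    also have "\<dots> = emeasure ?P (\<Union>n. E n)"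
      by (subst em(3)) auto
    also have "\<dots> = (SUP n. emeasure ?P (E n))"
      using inc by (intro SUP_emeasure_incseq [symmetric]) auto
    also have "\<dots> \<le> (SUP E\<in>{E. E \<in> sets borel \<and> bounded E \<and> E \<subseteq> A}. ennreal (\<nu> E))"
      unfolding eq using E bE sub by (intro SUP_least SUP_upper) auto
    finally show ?thesis .
  qed
  have "(SUP E\<in>{E. E \<in> sets borel \<and> bounded E \<and> E \<subseteq> A}. ennreal (\<nu> E)) = emeasure ?P A"
    if "A \<in> sets borel" for A
  proof (rule antisym[OF SUP_least ge[OF that]])
    fix E assume "E \<in> {E. E \<in> sets borel \<and> bounded E \<and> E \<subseteq> A}"
    then have "ennreal (\<nu> E) \<le> emeasure ?P E" "emeasure ?P E \<le> emeasure ?P A"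
      using that by (auto intro!: le emeasure_mono)
    then show "ennreal (\<nu> E) \<le> emeasure ?P A" by simp
  qed
  \<comment> \<open>\<open>pos_variation\<close> applies \<open>measure_of\<close> to a supremum
    whose countable additivity is not evident. Agreement with the measure \<open>?P\<close> on all
    Borel sets is what guarantees that the values are kept.\<close>
  then have "pos_variation \<nu> = measure_of (space ?P) (sets ?P) (emeasure ?P)"
    unfolding pos_variation_def using sets.sigma_sets_eq[of "borel :: 'a measure"]
    by (simp, intro measure_of_eq) auto
  then show ?thesis
    by (simp only: measure_of_of_measure)
qed

lemma sets_pos_variation [measurable_cong, simp]: "sets (pos_variation \<nu>) = sets borel"
proof (rule densities)
  fix s :: "'a measure" and f g :: "'a \<Rightarrow> real"
  assume *: "sets s = sets borel" "f \<in> borel_measurable borel" "g \<in> borel_measurable borel"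
    "\<And>x. 0 \<le> f x" "\<And>x. 0 \<le> g x" "\<alpha> = density s (\<lambda>x. ennreal (f x))" "\<beta> = density s (\<lambda>x. ennreal (g x))"
  show "sets (pos_variation \<nu>) = sets borel"
    unfolding pos_variation_eq_density[OF *] by (simp add: *(1))
qed

lemma space_pos_variation [simp]: "space (pos_variation \<nu>) = UNIV"
  using sets_eq_imp_space_eq[OF sets_pos_variation] by simp

text \<open>Integrate f <= g + (f - g)^+ for the densities. Finiteness of integrals against \<beta>
  and the positive variation thereby passes to \<alpha>, with nothing known about \<alpha>
  beforehand.\<close>

lemma nn_integral_alpha_le:
  assumes [measurable]: "u \<in> borel_measurable borel"
  shows "(\<integral>\<^sup>+x. u x \<partial>\<alpha>) \<le> (\<integral>\<^sup>+x. u x \<partial>\<beta>) + (\<integral>\<^sup>+x. u x \<partial>pos_variation \<nu>)"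
proof -
  obtain s f g where s [measurable_cong]: "sets s = sets borel"
    and [measurable]: "f \<in> borel_measurable borel" "g \<in> borel_measurable borel"
    and nonneg: "\<And>x. 0 \<le> f x" "\<And>x. 0 \<le> g x"
    and \<alpha>: "\<alpha> = density s (\<lambda>x. ennreal (f x))" and \<beta>: "\<beta> = density s (\<lambda>x. ennreal (g x))"
    using densities by metis
  have P: "pos_variation \<nu> = density s (\<lambda>x. ennreal (f x - g x))"
    by (rule pos_variation_eq_density[OF s _ _ nonneg \<alpha> \<beta>]) measurable
  have "ennreal (f x) \<le> ennreal (g x) + ennreal (f x - g x)" for x
    using nonneg[of x] by (cases "g x \<le> f x") (auto simp: ennreal_neg ennreal_leI simp flip: ennreal_plus)
  then have "ennreal (f x) * u x \<le> ennreal (g x) * u x + ennreal (f x - g x) * u x" for x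
    by (metis distrib_right mult_right_mono zero_le)
  then have "(\<integral>\<^sup>+x. ennreal (f x) * u x \<partial>s) \<le>
      (\<integral>\<^sup>+x. ennreal (g x) * u x + ennreal (f x - g x) * u x \<partial>s)"
    by (rule nn_integral_mono)
  also have "\<dots> = (\<integral>\<^sup>+x. ennreal (g x) * u x \<partial>s) + (\<integral>\<^sup>+x. ennreal (f x - g x) * u x \<partial>s)"
    by (rule nn_integral_add) measurable
  finally show ?thesis
    unfolding P unfolding \<alpha> \<beta> by (simp add: nn_integral_density)
qed

text \<open>The Jordan parts have densities (f - g)^+ <= f and (g - f)^+ <= g, so \<open>F\<close>
  is integrable against them as well, and the two weights recombine to f - g.\<close>

lemma signed_integral_eq:
  fixes F :: "'a \<Rightarrow> complex"
  assumes F: "integrable \<alpha> F" "integrable \<beta> F"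
  shows "signed_integral \<nu> F = (\<integral>x. F x \<partial>\<alpha>) - (\<integral>x. F x \<partial>\<beta>)"
proof -
  obtain s f g where s [measurable_cong]: "sets s = sets borel"
    and [measurable]: "f \<in> borel_measurable borel" "g \<in> borel_measurable borel"
    and nonneg: "\<And>x. 0 \<le> f x" "\<And>x. 0 \<le> g x"
    and \<alpha>: "\<alpha> = density s (\<lambda>x. ennreal (f x))" and \<beta>: "\<beta> = density s (\<lambda>x. ennreal (g x))"
    using densities by metis
  have [measurable]: "F \<in> borel_measurable borel"
    using F(1) by (auto cong: measurable_cong_sets)
  have P: "pos_variation \<nu> = density s (\<lambda>x. ennreal (f x - g x))"
    by (rule pos_variation_eq_density[OF s _ _ nonneg \<alpha> \<beta>]) measurable
  have N: "neg_variation \<nu> = density s (\<lambda>x. ennreal (g x - f x))"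
    unfolding neg_variation_def
    by (rule signed_local_measure.pos_variation_eq_density[OF swap s _ _ nonneg(2,1) \<beta> \<alpha>]) measurable
  have int: "integrable s (\<lambda>x. f x *\<^sub>R F x)" "integrable s (\<lambda>x. g x *\<^sub>R F x)"
    using F nonneg by (auto simp: \<alpha> \<beta> integrable_density)
  \<comment> \<open>Bochner integration against a density wants a nonnegative real weight; the
    truncation at 0 that is implicit in \<open>ennreal\<close> is made explicit.\<close>
  have *: "density s (\<lambda>x. ennreal (u x - v x)) = density s (\<lambda>x. ennreal (max 0 (u x - v x)))" for u v
    by (intro arg_cong[where f = "density s"] ext) (simp add: max_def ennreal_neg)
  have intP: "integrable s (\<lambda>x. max 0 (f x - g x) *\<^sub>R F x)"
    by (rule Bochner_Integration.integrable_bound[OF int(1)]) (use nonneg in \<open>auto intro!: mult_right_mono\<close>)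
  have intN: "integrable s (\<lambda>x. max 0 (g x - f x) *\<^sub>R F x)"
    by (rule Bochner_Integration.integrable_bound[OF int(2)]) (use nonneg in \<open>auto intro!: mult_right_mono\<close>)
  have "signed_integral \<nu> F = (\<integral>x. max 0 (f x - g x) *\<^sub>R F x \<partial>s) - (\<integral>x. max 0 (g x - f x) *\<^sub>R F x \<partial>s)"
    unfolding signed_integral_def P N * by (subst (1 2) integral_density) auto
  also have "\<dots> = (\<integral>x. f x *\<^sub>R F x - g x *\<^sub>R F x \<partial>s)"
    unfolding Bochner_Integration.integral_diff[OF intP intN, symmetric]
    by (intro Bochner_Integration.integral_cong) (auto simp: max_def algebra_simps simp flip: scaleR_diff_left)
  also have "\<dots> = (\<integral>x. F x \<partial>\<alpha>) - (\<integral>x. F x \<partial>\<beta>)"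
    unfolding \<alpha> \<beta> Bochner_Integration.integral_diff[OF int] using nonneg by (subst (1 2) integral_density) auto
  finally show ?thesis .
qed

lemma emeasure_total_variation:
  assumes "B \<in> sets borel"
  shows "emeasure (total_variation \<nu>) B = emeasure (pos_variation \<nu>) B + emeasure (neg_variation \<nu>) B"
proof -
  have [simp]: "sets (neg_variation \<nu>) = sets borel"
    unfolding neg_variation_def by (rule signed_local_measure.sets_pos_variation[OF swap])
  show ?thesis
    unfolding total_variation_def
  proof (rule emeasure_measure_of_sigma)
    show "sigma_algebra UNIV (sets (borel :: 'a measure))"
      using sets.sigma_algebra_axioms[of "borel :: 'a measure"] by simp
    show "positive (sets borel) (\<lambda>B. emeasure (pos_variation \<nu>) B + emeasure (neg_variation \<nu>) B)"
      by (simp add: positive_def)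
    show "countably_additive (sets borel) (\<lambda>B. emeasure (pos_variation \<nu>) B + emeasure (neg_variation \<nu>) B)"
      by (intro countably_additiveI) (simp add: suminf_add[symmetric] suminf_emeasure)
  qed fact
qed

text \<open>The weight is at least 1, so its integral dominates the total mass of |\<nu>| and with
  it the masses of both parts.\<close>

lemma finite_variations:
  assumes "(\<integral>\<^sup>+x. ennreal (1 + norm x powr p) \<partial>total_variation \<nu>) < \<infinity>"
  shows "finite_measure (pos_variation \<nu>)" "finite_measure (neg_variation \<nu>)"
proof -
  have [simp]: "sets (total_variation \<nu>) = sets borel"
    by (simp add: total_variation_def sigma_algebra.sets_measure_of_eq[OF sets.sigma_algebra_axioms[of borel, simplified]])
  have sp: "space (total_variation \<nu>) = UNIV"
    using sets_eq_imp_space_eq[of "total_variation \<nu>" borel] by simp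
  have "emeasure (total_variation \<nu>) UNIV = (\<integral>\<^sup>+x. 1 \<partial>total_variation \<nu>)"
    using sp by simp
  also have "\<dots> \<le> (\<integral>\<^sup>+x. ennreal (1 + norm x powr p) \<partial>total_variation \<nu>)"
    by (rule nn_integral_mono) simp
  finally have "emeasure (total_variation \<nu>) UNIV < \<infinity>"
    using assms by (rule le_less_trans)
  then have "emeasure (pos_variation \<nu>) UNIV + emeasure (neg_variation \<nu>) UNIV < \<infinity>"
    by (simp add: emeasure_total_variation)
  moreover have "space (neg_variation \<nu>) = UNIV"
    unfolding neg_variation_def by (rule signed_local_measure.space_pos_variation[OF swap])
  ultimately show "finite_measure (pos_variation \<nu>)" "finite_measure (neg_variation \<nu>)"
    by (auto intro!: finite_measureI)
qed

end


section \<open>Affine maps and Lebesgue measure\<close>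

lemma nn_integral_lborel_affine:
  fixes f :: "'a::euclidean_space \<Rightarrow> ennreal"
  assumes [measurable]: "f \<in> borel_measurable borel" and c: "c \<noteq> 0"
  shows "(\<integral>\<^sup>+x. f x \<partial>lborel) = ennreal (\<bar>c\<bar> ^ DIM('a)) * (\<integral>\<^sup>+x. f (t + c *\<^sub>R x) \<partial>lborel)"
  by (subst lborel_affine[OF c, of t])
     (simp add: nn_integral_density nn_integral_distr nn_integral_cmult ennreal_power)

lemma lborel_integrable_affine:
  fixes f :: "'a::euclidean_space \<Rightarrow> 'b::{banach, second_countable_topology}"
  assumes f: "integrable lborel f" and c: "c \<noteq> 0"
  shows "integrable lborel (\<lambda>x. f (t + c *\<^sub>R x))"
proof -
  have [measurable]: "f \<in> borel_measurable borel" using f by auto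
  have "ennreal (\<bar>c\<bar> ^ DIM('a)) * (\<integral>\<^sup>+x. norm (f (t + c *\<^sub>R x)) \<partial>lborel) < \<infinity>"
    using f c by (subst nn_integral_lborel_affine[symmetric]) (auto simp: integrable_iff_bounded)
  then show ?thesis
    using c by (auto simp: integrable_iff_bounded ennreal_mult_less_top)
qed

lemma lborel_integral_affine:
  fixes f :: "'a::euclidean_space \<Rightarrow> 'b::{banach, second_countable_topology}"
  assumes [measurable]: "f \<in> borel_measurable borel" and c: "c \<noteq> 0"
  shows "(\<integral>x. f x \<partial>lborel) = \<bar>c\<bar> ^ DIM('a) *\<^sub>R (\<integral>x. f (t + c *\<^sub>R x) \<partial>lborel)"
  by (subst lborel_affine[OF c, of t])
     (simp add: integral_density integral_distr ennreal_power)

text \<open>The indicator of the cube integrates to 1 over all translates, so it may be inserted; then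
  invariance moves the translation from the cube to \<open>f\<close>.\<close>
lemma translation_invariant_disintegration:
  fixes m :: "('a::euclidean_space \<times> 'b::euclidean_space) measure" and f :: "'a \<times> 'b \<Rightarrow> ennreal"
  assumes m [measurable_cong, simp]: "sets m = sets borel" and "sigma_finite_measure m"
    and inv: "\<And>t f. f \<in> borel_measurable borel \<Longrightarrow>
      (\<integral>\<^sup>+p. f (t + fst p, snd p) \<partial>m) = (\<integral>\<^sup>+p. (f p :: ennreal) \<partial>m)"
    and f: "f \<in> borel_measurable borel"
  shows "(\<integral>\<^sup>+p. f p \<partial>m) = (\<integral>\<^sup>+p. indicator (cbox 0 One) (fst p) * (\<integral>\<^sup>+y. f (y, snd p) \<partial>lborel) \<partial>m)"
proof -
  interpret sigma_finite_measure m by fact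
  interpret pair_sigma_finite m "lborel :: 'a measure" ..
  have [measurable]: "f \<in> borel_measurable (borel \<Otimes>\<^sub>M borel)"
    using f by (simp add: borel_prod)
  have [measurable_cong]: "sets m = sets (borel \<Otimes>\<^sub>M borel)"
    by (simp only: m borel_prod)
  let ?C = "indicator (cbox 0 One) :: 'a \<Rightarrow> ennreal"
  have cube: "(\<integral>\<^sup>+y. ?C (x + y) \<partial>lborel) = 1" for x :: 'a
    using nn_integral_lborel_affine[of ?C 1 x] by simp
  \<comment> \<open>Once the translation has moved to f, the argument is \<open>x - y\<close>.
    Reflection and translation preserve Lebesgue measure, so only the second coordinate of the pair
    is left in the inner integral.\<close>
  have refl: "(\<integral>\<^sup>+y. f (x - y, z) \<partial>lborel) = (\<integral>\<^sup>+y. f (y, z) \<partial>lborel)" for x z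
    using nn_integral_lborel_affine[of "\<lambda>y. f (y, z)" "-1" x] by simp
  have "(\<integral>\<^sup>+p. f p \<partial>m) = (\<integral>\<^sup>+p. f p * (\<integral>\<^sup>+y. ?C (fst p + y) \<partial>lborel) \<partial>m)"
    by (simp add: cube)
  also have "\<dots> = (\<integral>\<^sup>+p. \<integral>\<^sup>+y. f p * ?C (fst p + y) \<partial>lborel \<partial>m)"
    by (intro nn_integral_cong nn_integral_cmult[symmetric]) measurable
  also have "\<dots> = (\<integral>\<^sup>+y. \<integral>\<^sup>+p. f p * ?C (fst p + y) \<partial>m \<partial>lborel)"
    by (rule Fubini'[symmetric]) measurable
  also have "\<dots> = (\<integral>\<^sup>+y. \<integral>\<^sup>+p. ?C (fst p) * f (fst p - y, snd p) \<partial>m \<partial>lborel)"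
  proof (rule nn_integral_cong)
    fix y
    have "(\<lambda>p. ?C (fst p) * f (fst p - y, snd p)) \<in> borel_measurable (borel \<Otimes>\<^sub>M borel)"
      by measurable
    then show "(\<integral>\<^sup>+p. f p * ?C (fst p + y) \<partial>m) = (\<integral>\<^sup>+p. ?C (fst p) * f (fst p - y, snd p) \<partial>m)"
      using inv[of "\<lambda>p. ?C (fst p) * f (fst p - y, snd p)" y]
      by (simp add: borel_prod algebra_simps)
  qed
  also have "\<dots> = (\<integral>\<^sup>+p. \<integral>\<^sup>+y. ?C (fst p) * f (fst p - y, snd p) \<partial>lborel \<partial>m)"
    by (rule Fubini') measurable
  also have "\<dots> = (\<integral>\<^sup>+p. ?C (fst p) * (\<integral>\<^sup>+y. f (fst p - y, snd p) \<partial>lborel) \<partial>m)"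
    by (intro nn_integral_cong nn_integral_cmult) measurable
  finally show ?thesis
    by (simp add: refl)
qed

section \<open>Configurations of points\<close>

lemma countable_locally_finite:
  assumes "locally_finite_set A"
  shows "countable A"
proof -
  have "A = (\<Union>n::nat. A \<inter> ball 0 (real n))"
    using reals_Archimedean2 by (auto simp: dist_norm)
  moreover have "countable (\<Union>n::nat. A \<inter> ball 0 (real n))"
    using assms by (intro countable_UN) (auto simp: locally_finite_set_def intro: countable_finite)
  ultimately show ?thesis by simp
qed

lemma space_config_space [simp]: "space config_space = {A. locally_finite_set A}"
  unfolding config_space_def by (rule space_measure_of) auto

lemma measurable_npoints [measurable]:
  assumes "B \<in> sets borel"
  shows "(\<lambda>A. npoints A B) \<in> borel_measurable config_space"
proof (rule measurableI)
  fix C :: "ennreal set" assume "C \<in> sets borel"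
  with assms have "{A. locally_finite_set A \<and> npoints A B \<in> C} \<in> sets config_space"
    unfolding config_space_def by (intro in_measure_of) auto
  then show "(\<lambda>A. npoints A B) -` C \<inter> space config_space \<in> sets config_space"
    by (simp add: vimage_def Int_def conj_commute)
qed simp

lemma measurable_config_spaceI:
  fixes X :: "'w \<Rightarrow> 'a::euclidean_space set"
  assumes "\<And>\<omega>. \<omega> \<in> space M \<Longrightarrow> locally_finite_set (X \<omega>)"
    and [measurable]: "\<And>B. B \<in> sets borel \<Longrightarrow> (\<lambda>\<omega>. npoints (X \<omega>) B) \<in> borel_measurable M"
  shows "X \<in> M \<rightarrow>\<^sub>M config_space"
  unfolding config_space_def
proof (rule measurable_measure_of)
  fix S :: "'a set set"
  assume "S \<in> {{A. locally_finite_set A \<and> npoints A B \<in> C} |B C. B \<in> sets borel \<and> C \<in> sets borel}"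
  then obtain B C where S: "S = {A. locally_finite_set A \<and> npoints A B \<in> C}"
      and [measurable]: "B \<in> sets borel" "C \<in> sets borel" by blast
  have "X -` S \<inter> space M = (\<lambda>\<omega>. npoints (X \<omega>) B) -` C \<inter> space M"
    using assms(1) by (auto simp: S)
  then show "X -` S \<inter> space M \<in> sets M" by simp
qed (use assms(1) in auto)

lemma translate_Int: "(+) t ` A \<inter> B = (+) t ` (A \<inter> (+) t -` B)" for t :: "'a::ab_group_add"
  by auto

lemma npoints_translate: "npoints ((+) t ` A) B = npoints A ((+) t -` B)" for t :: "'a::ab_group_add"
  unfolding npoints_def translate_Int by (simp add: emeasure_count_space card_image finite_image_iff)

lemma locally_finite_translate:
  assumes "locally_finite_set A"
  shows "locally_finite_set ((+) t ` A)"
  unfolding locally_finite_set_def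
proof (intro allI impI)
  fix B :: "'a set" assume "bounded B"
  then obtain b where b: "norm x \<le> b" if "x \<in> B" for x
    by (auto simp: bounded_iff)
  have "norm y \<le> b + norm t" if "t + y \<in> B" for y
    using b[OF that] norm_triangle_ineq4[of "t + y" t] by simp
  then have "bounded ((+) t -` B)"
    by (auto simp: bounded_iff)
  then show "finite ((+) t ` A \<inter> B)"
    using assms by (auto simp: locally_finite_set_def translate_Int)
qed

lemma measurable_translate_config [measurable]: "(\<lambda>A. (+) t ` A) \<in> config_space \<rightarrow>\<^sub>M config_space"
proof (rule measurable_config_spaceI)
  fix B :: "'a set" assume "B \<in> sets borel"
  then have "(+) t -` B \<in> sets borel"
    using measurable_sets[of "(+) t" borel borel B] by simp
  then show "(\<lambda>A. npoints ((+) t ` A) B) \<in> borel_measurable config_space"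
    unfolding npoints_translate by measurable
qed (simp add: locally_finite_translate)

lemma emeasure_count_space_Times:
  assumes "finite A" "finite B"
  shows "emeasure (count_space UNIV) (A \<times> B) =
    emeasure (count_space UNIV) A * emeasure (count_space UNIV) B"
  using assms by (simp add: emeasure_count_space card_cartesian_product)

text \<open>The sigma-field on configurations only provides counts of points. Over a rectangle the
  count of pairs is a product of two such counts, and a Dynkin argument extends this to all Borel
  sets of pairs. The bounded window \<open>Q n\<close> keeps every count finite, so that complements
  become subtractions; the window is removed by monotone limits.\<close>

lemma measurable_count_pairs [measurable]:
  fixes D :: "('a::euclidean_space \<times> 'a) set"
  assumes "D \<in> sets borel"
  shows "(\<lambda>A. emeasure (count_space UNIV) (A \<times> A \<inter> D)) \<in> borel_measurable config_space"
proof -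
  define Q where "Q n = ball (0::'a) (real n) \<times> ball (0::'a) (real n)" for n
  have fin: "finite (A \<inter> ball 0 (real n))" if "A \<in> space config_space" for A :: "'a set" and n
    using that by (simp add: locally_finite_set_def)
  have AQ: "A \<times> A \<inter> Q n = (A \<inter> ball 0 (real n)) \<times> (A \<inter> ball 0 (real n))" for A n
    by (auto simp: Q_def)
  have finQ: "finite (A \<times> A \<inter> Q n)" if "A \<in> space config_space" for A n
    unfolding AQ using fin[OF that] by blast
  have meas_n: "(\<lambda>A. emeasure (count_space UNIV) (A \<times> A \<inter> Q n \<inter> D)) \<in> borel_measurable config_space" for n
  proof -
    have eq: "sets (borel :: ('a \<times> 'a) measure) = sigma_sets UNIV {S \<times> T |S T. S \<in> sets borel \<and> T \<in> sets borel}"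
      unfolding borel_prod[symmetric] sets_pair_measure by simp
    have rect: "(\<lambda>A. emeasure (count_space UNIV) (A \<times> A \<inter> Q n \<inter> S \<times> T)) \<in> borel_measurable config_space"
      if [measurable]: "S \<in> sets borel" "T \<in> sets borel" for S T
    proof -
      have "emeasure (count_space UNIV) (A \<times> A \<inter> Q n \<inter> S \<times> T) =
          npoints A (ball 0 (real n) \<inter> S) * npoints A (ball 0 (real n) \<inter> T)" if "A \<in> space config_space" for A
      proof -
        have "A \<times> A \<inter> Q n \<inter> S \<times> T = (A \<inter> (ball 0 (real n) \<inter> S)) \<times> (A \<inter> (ball 0 (real n) \<inter> T))"
          by (auto simp: Q_def)
        then show ?thesis
          using finite_subset[OF _ fin[OF that, of n]]
          by (simp add: npoints_def emeasure_count_space_Times Int_assoc[symmetric])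
      qed
      then show ?thesis by (subst measurable_cong) auto
    qed
    have closed: "{S \<times> T |S T. S \<in> sets borel \<and> T \<in> sets (borel :: 'a measure)} \<subseteq> Pow UNIV"
      by simp
    show ?thesis
      using assms unfolding eq
    proof (induction rule: sigma_sets_induct_disjoint[OF Int_stable_pair_measure_generator closed, consumes 1, case_names basic empty compl union])
      case (basic S)
      then show ?case using rect by auto
    next
      case empty
      show ?case by simp
    next
      case (compl S)
      have "emeasure (count_space UNIV) (A \<times> A \<inter> Q n \<inter> (UNIV - S)) =
         emeasure (count_space UNIV) (A \<times> A \<inter> Q n \<inter> UNIV \<times> UNIV) - emeasure (count_space UNIV) (A \<times> A \<inter> Q n \<inter> S)"
        if "A \<in> space config_space" for A
      proof -
        have "emeasure (count_space UNIV) (A \<times> A \<inter> Q n \<inter> S) \<noteq> \<infinity>"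
          using finQ[OF that, of n] by (simp add: emeasure_count_space)
        then have "emeasure (count_space UNIV) (A \<times> A \<inter> Q n - A \<times> A \<inter> Q n \<inter> S) =
            emeasure (count_space UNIV) (A \<times> A \<inter> Q n) - emeasure (count_space UNIV) (A \<times> A \<inter> Q n \<inter> S)"
          by (intro emeasure_Diff) auto
        moreover have "A \<times> A \<inter> Q n - A \<times> A \<inter> Q n \<inter> S = A \<times> A \<inter> Q n \<inter> (UNIV - S)"
          by blast
        ultimately show ?thesis by simp
      qed
      moreover have "(\<lambda>A. emeasure (count_space UNIV) (A \<times> A \<inter> Q n \<inter> UNIV \<times> UNIV) -
          emeasure (count_space UNIV) (A \<times> A \<inter> Q n \<inter> S)) \<in> borel_measurable config_space"
        using compl(2) rect[of UNIV UNIV] by (intro borel_measurable_minus_ennreal) auto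
      ultimately show ?case by (subst measurable_cong) auto
    next
      case (union S)
      have "emeasure (count_space UNIV) (A \<times> A \<inter> Q n \<inter> (\<Union>i. S i)) =
          (\<Sum>i. emeasure (count_space UNIV) (A \<times> A \<inter> Q n \<inter> S i))" for A
        using union(1) by (subst suminf_emeasure) (auto simp: disjoint_family_on_def)
      then show ?case
        using union(3) by simp
    qed
  qed
  have "emeasure (count_space UNIV) (A \<times> A \<inter> D) =
      (SUP n. emeasure (count_space UNIV) (A \<times> A \<inter> Q n \<inter> D))" for A
  proof -
    have "incseq (\<lambda>n. A \<times> A \<inter> Q n \<inter> D)"
      by (auto simp: incseq_def Q_def)
    moreover have "\<exists>n. norm x < real n \<and> norm y < real n" for x y :: 'a
      using reals_Archimedean2[of "max (norm x) (norm y)"] by auto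
    then have "(\<Union>n. A \<times> A \<inter> Q n \<inter> D) = A \<times> A \<inter> D"
      by (auto simp: Q_def dist_norm)
    ultimately show ?thesis
      by (subst SUP_emeasure_incseq) auto
  qed
  then show ?thesis
    using meas_n by simp
qed


text \<open>The counting measure of ordered pairs, pushed to difference coordinates. The diagonal is
  included and sits at second coordinate 0, where it is a copy of the configuration itself.\<close>

definition pair_kernel :: "'a::euclidean_space set \<Rightarrow> ('a \<times> 'a) measure" where
  "pair_kernel A = distr (count_space (A \<times> A)) borel (\<lambda>(x, y). (x, y - x))"

lemma sets_pair_kernel [measurable_cong, simp]: "sets (pair_kernel A) = sets borel"
  by (simp add: pair_kernel_def)

lemma measurable_shear: "(\<lambda>(x, y). (x, y - x)) \<in> borel \<rightarrow>\<^sub>M (borel :: ('a::euclidean_space \<times> 'a) measure)"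
  unfolding borel_prod[symmetric] by measurable

lemma emeasure_pair_kernel:
  assumes "D \<in> sets borel"
  shows "emeasure (pair_kernel A) D =
    emeasure (count_space UNIV) (A \<times> A \<inter> (\<lambda>(x, y). (x, y - x)) -` D)"
  using assms unfolding pair_kernel_def
  by (subst emeasure_distr) (auto simp: emeasure_count_space Int_commute)

lemma nn_integral_pair_kernel:
  assumes "f \<in> borel_measurable borel"
  shows "(\<integral>\<^sup>+p. f p \<partial>pair_kernel A) = (\<integral>\<^sup>+p. f (fst p, snd p - fst p) \<partial>count_space (A \<times> A))"
  unfolding pair_kernel_def using assms by (subst nn_integral_distr) (auto simp: case_prod_beta)

lemma integral_pair_kernel:
  fixes f :: "_ \<Rightarrow> 'c::{banach, second_countable_topology}"
  assumes "f \<in> borel_measurable borel"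
  shows "(\<integral>p. f p \<partial>pair_kernel A) = infsetsum (\<lambda>p. f (fst p, snd p - fst p)) (A \<times> A)"
  unfolding pair_kernel_def infsetsum_def using assms by (subst integral_distr) (auto simp: case_prod_beta)

lemma integrable_pair_kernel_iff:
  fixes f :: "_ \<Rightarrow> 'c::{banach, second_countable_topology}"
  assumes "f \<in> borel_measurable borel"
  shows "integrable (pair_kernel A) f \<longleftrightarrow> Infinite_Set_Sum.abs_summable_on (\<lambda>p. f (fst p, snd p - fst p)) (A \<times> A)"
  unfolding pair_kernel_def Infinite_Set_Sum.abs_summable_on_def using assms
  by (subst integrable_distr_eq) (auto simp: case_prod_beta)

text \<open>Shifting both points by t moves the first coordinate and leaves the difference
  alone.\<close>

lemma nn_integral_pair_kernel_translate:
  assumes [measurable]: "f \<in> borel_measurable borel"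
  shows "(\<integral>\<^sup>+p. f (t + fst p, snd p) \<partial>pair_kernel A) = (\<integral>\<^sup>+p. f p \<partial>pair_kernel ((+) t ` A))"
proof -
  have "f \<in> borel_measurable (borel \<Otimes>\<^sub>M borel)"
    by (simp add: borel_prod)
  then have "(\<lambda>p. f (t + fst p, snd p)) \<in> borel_measurable (borel \<Otimes>\<^sub>M borel)"
    by measurable
  then have [measurable]: "(\<lambda>p. f (t + fst p, snd p)) \<in> borel_measurable borel"
    by (simp add: borel_prod)
  have "bij_betw (map_prod ((+) t) ((+) t)) (A \<times> A) ((+) t ` A \<times> (+) t ` A)"
    by (auto simp: bij_betw_def inj_on_def map_prod_surj_on)
  then have "(\<integral>\<^sup>+p. f (fst (map_prod ((+) t) ((+) t) p), snd (map_prod ((+) t) ((+) t) p) - fst (map_prod ((+) t) ((+) t) p)) \<partial>count_space (A \<times> A)) =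
      (\<integral>\<^sup>+p. f (fst p, snd p - fst p) \<partial>count_space ((+) t ` A \<times> (+) t ` A))"
    by (rule nn_integral_bij_count_space)
  then show ?thesis
    by (simp add: nn_integral_pair_kernel)
qed

lemma measure_kernel_pair_kernel: "measure_kernel config_space borel pair_kernel"
proof
  fix D :: "('a \<times> 'a) set" assume D: "D \<in> sets borel"
  then have "(\<lambda>(x, y). (x, y - x)) -` D \<in> sets borel"
    using measurable_sets[OF measurable_shear D] by simp
  then show "(\<lambda>A. emeasure (pair_kernel A) D) \<in> borel_measurable config_space"
    unfolding emeasure_pair_kernel[OF D] by measurable
qed simp

lemma emeasure_pair_kernel_diagonal:
  fixes S :: "'a::euclidean_space set"
  assumes [measurable]: "S \<in> sets borel"
  shows "emeasure (pair_kernel A) (S \<times> {0}) = npoints A S"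
proof -
  have "bij_betw (\<lambda>x. (x, x)) (A \<inter> S) (A \<times> A \<inter> (\<lambda>(x, y). (x, y - x)) -` (S \<times> {0}))"
    by (auto simp: bij_betw_def inj_on_def image_iff)
  note bij = bij_betw_same_card[OF this] bij_betw_finite[OF this]
  have "S \<times> {0 :: 'a} \<in> sets (borel \<Otimes>\<^sub>M borel)" by (intro pair_measureI borel_closed[OF closed_singleton] assms)
  then have "S \<times> {0 :: 'a} \<in> sets (borel :: ('a \<times> 'a) measure)" by (simp only: borel_prod)
  then show ?thesis
    using bij by (simp add: emeasure_pair_kernel npoints_def emeasure_count_space)
qed

text \<open>The factor \<open>indicator {0} (snd p)\<close> selects the diagonal, hence the single
  points. The first identity holds for every set \<open>A\<close>: summability in the complex
  numbers is absolute summability, and where it fails \<open>infsum\<close> and the Bochner integral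
  are both 0. Measurability of \<open>infsum\<close> over the process therefore follows without
  exceptional events.\<close>

lemma infsum_eq_integral_pair_kernel:
  fixes f :: "'a::euclidean_space \<Rightarrow> complex"
  assumes "f \<in> borel_measurable borel"
  shows "infsum f A = (\<integral>p. f (fst p) * indicator {0} (snd p) \<partial>pair_kernel A)"
    and "Infinite_Set_Sum.abs_summable_on f A \<longleftrightarrow> integrable (pair_kernel A) (\<lambda>p. f (fst p) * indicator {0} (snd p))"
proof -
  have "(\<lambda>p. f (fst p) * indicator {0 :: 'a} (snd p)) \<in> borel_measurable (borel \<Otimes>\<^sub>M borel)"
    by (intro borel_measurable_times measurable_compose[OF measurable_fst assms]
        measurable_compose[OF measurable_snd borel_measurable_indicator] borel_closed[OF closed_singleton])
  then have meas: "(\<lambda>p. f (fst p) * indicator {0} (snd p)) \<in> borel_measurable (borel :: ('a \<times> 'a) measure)"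
    by (simp add: borel_prod)
  have inj: "inj_on (\<lambda>x. (x, x)) A"
    by (auto simp: inj_on_def)
  let ?F = "\<lambda>(x, y). f x * indicator {0} (y - x) :: complex"
  have "infsetsum f A = infsetsum (\<lambda>x. ?F (x, x)) A"
    by (intro infsetsum_cong) auto
  also have "\<dots> = infsetsum ?F ((\<lambda>x. (x, x)) ` A)"
    by (rule infsetsum_reindex[OF inj, symmetric])
  also have "\<dots> = infsetsum ?F (A \<times> A)"
    by (rule infsetsum_cong_neutral) (auto simp: indicator_def split: if_splits)
  also have "\<dots> = (\<integral>p. f (fst p) * indicator {0} (snd p) \<partial>pair_kernel A)"
    using meas by (subst integral_pair_kernel) (auto simp: case_prod_beta)
  finally have eq: "infsetsum f A = (\<integral>p. f (fst p) * indicator {0} (snd p) \<partial>pair_kernel A)" .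
  show "infsum f A = (\<integral>p. f (fst p) * indicator {0} (snd p) \<partial>pair_kernel A)"
  proof (cases "Infinite_Set_Sum.abs_summable_on f A")
    case True
    then show ?thesis using infsetsum_infsum[of f A] eq by simp
  next
    case False
    then have "\<not> f summable_on A"
      using summable_on_iff_abs_summable_on_complex abs_summable_equivalent by blast
    then show ?thesis
      using False eq by (simp add: infsum_not_exists not_summable_infsetsum_eq)
  qed
  have "Infinite_Set_Sum.abs_summable_on f A \<longleftrightarrow> Infinite_Set_Sum.abs_summable_on (\<lambda>x. ?F (x, x)) A"
    by (intro abs_summable_on_cong) auto
  also have "\<dots> \<longleftrightarrow> Infinite_Set_Sum.abs_summable_on ?F ((\<lambda>x. (x, x)) ` A)"
    by (rule abs_summable_on_reindex_iff[OF inj])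
  also have "\<dots> \<longleftrightarrow> Infinite_Set_Sum.abs_summable_on ?F (A \<times> A)"
    by (rule abs_summable_on_cong_neutral) (auto simp: indicator_def split: if_splits)
  also have "\<dots> \<longleftrightarrow> integrable (pair_kernel A) (\<lambda>p. f (fst p) * indicator {0} (snd p))"
    using meas by (subst integrable_pair_kernel_iff) (auto simp: case_prod_beta)
  finally show "Infinite_Set_Sum.abs_summable_on f A \<longleftrightarrow>
      integrable (pair_kernel A) (\<lambda>p. f (fst p) * indicator {0} (snd p))" .
qed


section \<open>Second moments of stationary point processes\<close>

locale square_integrable_stationary_process =
  fixes M :: "'w measure" and \<eta> :: "'w \<Rightarrow> 'a::euclidean_space set"
  assumes point_process: "point_process M \<eta>" and stationary: "stationary M \<eta>"
    and square_integrable: "locally_square_integrable M \<eta>"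
begin

lemma prob_space: "prob_space M" and measurable_process [measurable]: "\<eta> \<in> M \<rightarrow>\<^sub>M config_space"
  using point_process by (auto simp: point_process_def)

lemma locally_finite: "\<omega> \<in> space M \<Longrightarrow> locally_finite_set (\<eta> \<omega>)"
  using measurable_space[OF measurable_process] by simp

text \<open>From here on, \<open>mean\<close> is the expected counting measure of (x, y - x) over
  all ordered pairs of points of the process, with x = y allowed.\<close>

sublocale measure_kernel M "borel :: ('a \<times> 'a) measure" "\<lambda>\<omega>. pair_kernel (\<eta> \<omega>)"
proof
  fix D :: "('a \<times> 'a) set" assume "D \<in> sets borel"
  then show "(\<lambda>\<omega>. emeasure (pair_kernel (\<eta> \<omega>)) D) \<in> borel_measurable M"
    by (rule measurable_compose[OF measurable_process measure_kernel.measurable_kernel[OF measure_kernel_pair_kernel]])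
qed simp

text \<open>Translating the first coordinate amounts to translating the configuration, and the
  integral over pairs is a measurable functional of the configuration, so its mean depends on the
  distribution of the process only.\<close>

lemma nn_integral_mean_translate:
  assumes f: "f \<in> borel_measurable borel"
  shows "(\<integral>\<^sup>+p. f (t + fst p, snd p) \<partial>mean) = (\<integral>\<^sup>+p. f p \<partial>mean)"
proof -
  have "(\<lambda>p. f (t + fst p, snd p)) \<in> borel_measurable (borel \<Otimes>\<^sub>M borel)"
    using f unfolding borel_prod[symmetric] by measurable
  then have [measurable]: "(\<lambda>p. f (t + fst p, snd p)) \<in> borel_measurable borel"
    by (simp add: borel_prod)
  have [measurable]: "(\<lambda>A. \<integral>\<^sup>+p. f p \<partial>pair_kernel A) \<in> borel_measurable config_space"
    by (rule measure_kernel.measurable_nn_integral_kernel[OF measure_kernel_pair_kernel f])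
  have "(\<integral>\<^sup>+p. f (t + fst p, snd p) \<partial>mean) = (\<integral>\<^sup>+\<omega>. \<integral>\<^sup>+p. f p \<partial>pair_kernel ((+) t ` \<eta> \<omega>) \<partial>M)"
    by (subst nn_integral_mean) (simp_all add: nn_integral_pair_kernel_translate[OF f])
  also have "\<dots> = (\<integral>\<^sup>+A. \<integral>\<^sup>+p. f p \<partial>pair_kernel A \<partial>distr M config_space (\<lambda>\<omega>. (+) t ` \<eta> \<omega>))"
    by (subst nn_integral_distr) auto
  also have "\<dots> = (\<integral>\<^sup>+A. \<integral>\<^sup>+p. f p \<partial>pair_kernel A \<partial>distr M config_space \<eta>)"
    using stationary by (simp add: stationary_def)
  also have "\<dots> = (\<integral>\<^sup>+p. f p \<partial>mean)"
    by (subst nn_integral_distr) (auto simp: nn_integral_mean f)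
  finally show ?thesis .
qed

lemma Times_in_borel: "S \<in> sets borel \<Longrightarrow> T \<in> sets borel \<Longrightarrow> S \<times> T \<in> sets (borel :: ('a \<times> 'a) measure)"
  unfolding borel_prod[symmetric] by (rule pair_measureI)

lemma emeasure_mean_bounded:
  assumes "bounded S" "bounded T" and [measurable]: "S \<in> sets borel" "T \<in> sets borel"
  shows "emeasure mean (S \<times> T) < \<infinity>"
proof -
  obtain a where a: "norm x \<le> a" if "x \<in> S" for x
    using \<open>bounded S\<close> by (auto simp: bounded_iff)
  obtain b where b: "norm x \<le> b" if "x \<in> T" for x
    using \<open>bounded T\<close> by (auto simp: bounded_iff)
  \<comment> \<open>If x lies in \<open>S\<close> and y - x in \<open>T\<close>, both x and y lie in
    this ball, so the pairs number at most the squared count of \<open>B\<close>. The absolute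
    values cover the case that \<open>S\<close> or \<open>T\<close> is empty and its bound is
    negative.\<close>
  define B where "B = cball (0::'a) (\<bar>a\<bar> + \<bar>b\<bar>)"
  have [simp]: "B \<in> sets borel" "bounded B"
    by (auto simp: B_def)
  have "emeasure (pair_kernel (\<eta> \<omega>)) (S \<times> T) \<le> (npoints (\<eta> \<omega>) B)\<^sup>2" if "\<omega> \<in> space M" for \<omega>
  proof -
    have fin: "finite (\<eta> \<omega> \<inter> B)"
      using locally_finite[OF that] by (simp add: locally_finite_set_def)
    have "norm y \<le> \<bar>a\<bar> + \<bar>b\<bar>" if "x \<in> S" "y - x \<in> T" for x y
      using a[OF that(1)] b[OF that(2)] norm_triangle_ineq[of x "y - x"] by simp
    moreover have "norm x \<le> \<bar>a\<bar> + \<bar>b\<bar>" if "x \<in> S" for x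
      using a[OF that(1)] by simp
    ultimately have "\<eta> \<omega> \<times> \<eta> \<omega> \<inter> (\<lambda>(x, y). (x, y - x)) -` (S \<times> T) \<subseteq> (\<eta> \<omega> \<inter> B) \<times> (\<eta> \<omega> \<inter> B)"
      by (auto simp: B_def)
    then have "emeasure (count_space UNIV) (\<eta> \<omega> \<times> \<eta> \<omega> \<inter> (\<lambda>(x, y). (x, y - x)) -` (S \<times> T)) \<le>
        emeasure (count_space UNIV) ((\<eta> \<omega> \<inter> B) \<times> (\<eta> \<omega> \<inter> B))"
      by (rule emeasure_mono) simp
    then show ?thesis
      using fin by (simp add: emeasure_pair_kernel Times_in_borel npoints_def emeasure_count_space_Times power2_eq_square)
  qed
  then have "emeasure mean (S \<times> T) \<le> (\<integral>\<^sup>+\<omega>. (npoints (\<eta> \<omega>) B)\<^sup>2 \<partial>M)"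
    by (subst emeasure_mean) (auto intro!: nn_integral_mono Times_in_borel)
  also have "\<dots> < \<infinity>"
    using square_integrable by (simp add: locally_square_integrable_def)
  finally show ?thesis .
qed

lemma sigma_finite_mean: "sigma_finite_measure mean"
proof
  let ?A = "\<lambda>n::nat. ball (0::'a) (real n) \<times> ball (0::'a) (real n)"
  have "\<exists>n. norm x < real n \<and> norm y < real n" for x y :: 'a
    using reals_Archimedean2[of "max (norm x) (norm y)"] by auto
  then have "(\<Union>n. ?A n) = UNIV"
    by (auto simp: dist_norm)
  moreover have "emeasure mean (?A n) \<noteq> \<infinity>" for n
    using emeasure_mean_bounded[of "ball 0 (real n)" "ball 0 (real n)"] by auto
  ultimately show "\<exists>A. countable A \<and> A \<subseteq> sets mean \<and> \<Union>A = space mean \<and> (\<forall>a\<in>A. emeasure mean a \<noteq> \<infinity>)"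
    by (intro exI[of _ "range ?A"]) (auto intro: Times_in_borel)
qed

text \<open>The reduced second moment measure, which also counts the pairs \<open>x = y\<close>.\<close>
definition reduced :: "'a measure" where
  "reduced = distr (density mean (\<lambda>p. indicator (cbox 0 One) (fst p))) borel snd"

lemma sets_reduced [measurable_cong, simp]: "sets reduced = sets borel"
  by (simp add: reduced_def)

lemma space_reduced [simp]: "space reduced = UNIV"
  by (simp add: reduced_def)

lemma measurable_fst_borel [measurable]: "fst \<in> (borel :: ('a \<times> 'a) measure) \<rightarrow>\<^sub>M borel"
  and measurable_snd_borel [measurable]: "snd \<in> (borel :: ('a \<times> 'a) measure) \<rightarrow>\<^sub>M borel"
  unfolding borel_prod[symmetric] by measurable

lemma nn_integral_reduced:
  assumes [measurable]: "f \<in> borel_measurable borel"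
  shows "(\<integral>\<^sup>+z. f z \<partial>reduced) = (\<integral>\<^sup>+p. indicator (cbox 0 One) (fst p) * f (snd p) \<partial>mean)"
  unfolding reduced_def by (simp add: nn_integral_distr nn_integral_density)

lemma emeasure_reduced:
  assumes [measurable]: "B \<in> sets borel"
  shows "emeasure reduced B = emeasure mean (cbox 0 One \<times> B)"
proof -
  have "emeasure reduced B = (\<integral>\<^sup>+z. indicator B z \<partial>reduced)"
    by simp
  also have "\<dots> = (\<integral>\<^sup>+p. indicator (cbox 0 One \<times> B) p \<partial>mean)"
    by (subst nn_integral_reduced) (auto intro!: nn_integral_cong simp: indicator_def)
  finally show ?thesis
    by (simp add: Times_in_borel)
qed

lemma emeasure_reduced_bounded:
  assumes "bounded B" "B \<in> sets borel"
  shows "emeasure reduced B < \<infinity>"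
  using assms by (simp add: emeasure_reduced emeasure_mean_bounded[simplified])

lemma sigma_finite_reduced: "sigma_finite_measure reduced"
proof
  have "(\<Union>n::nat. ball (0::'a) (real n)) = UNIV"
    using reals_Archimedean2 by (auto simp: dist_norm)
  moreover have "emeasure reduced (ball (0::'a) (real n)) \<noteq> \<infinity>" for n
    using emeasure_reduced_bounded[of "ball 0 (real n)"] by auto
  ultimately show "\<exists>A. countable A \<and> A \<subseteq> sets reduced \<and> \<Union>A = space reduced \<and> (\<forall>a\<in>A. emeasure reduced a \<noteq> \<infinity>)"
    by (intro exI[of _ "range (\<lambda>n::nat. ball (0::'a) (real n))"]) auto
qed

text \<open>For an indicator, \<open>translation_invariant_disintegration\<close> yields the
  integral of the Lebesgue measure of the sections with respect to \<open>reduced\<close>. This is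
  the value of the product measure, both factors being sigma-finite.\<close>

lemma mean_eq_pair_measure: "mean = lborel \<Otimes>\<^sub>M reduced"
proof (rule measure_eqI)
  interpret r: sigma_finite_measure reduced by (rule sigma_finite_reduced)
  interpret pair_sigma_finite "lborel :: 'a measure" reduced ..
  have sets_eq: "sets (lborel \<Otimes>\<^sub>M reduced) = sets (borel \<Otimes>\<^sub>M borel)"
    by (rule sets_pair_measure_cong) simp_all
  show "sets mean = sets (lborel \<Otimes>\<^sub>M reduced)"
    by (simp only: sets_mean sets_eq borel_prod)
  fix D assume "D \<in> sets mean"
  then have D: "D \<in> sets (borel \<Otimes>\<^sub>M borel)" "D \<in> sets borel" by (simp_all only: sets_mean borel_prod)
  note [measurable] = D
  have "emeasure mean D = (\<integral>\<^sup>+p. indicator D p \<partial>mean)"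
    using D by simp
  also have "\<dots> = (\<integral>\<^sup>+p. indicator (cbox 0 One) (fst p) * (\<integral>\<^sup>+y. indicator D (y, snd p) \<partial>lborel) \<partial>mean)"
    by (rule translation_invariant_disintegration)
      (auto intro: nn_integral_mean_translate sigma_finite_mean)
  also have "\<dots> = (\<integral>\<^sup>+z. \<integral>\<^sup>+y. indicator D (y, z) \<partial>lborel \<partial>reduced)"
    by (rule nn_integral_reduced [symmetric]) measurable
  also have "\<dots> = (\<integral>\<^sup>+z. emeasure lborel ((\<lambda>y. (y, z)) -` D) \<partial>reduced)"
  proof (rule nn_integral_cong)
    fix z
    have "(\<lambda>y. (y, z)) -` D \<in> sets borel"
      using measurable_sets[OF measurable_Pair2' D(1)] by simp
    moreover have "indicator D (y, z) = (indicator ((\<lambda>y. (y, z)) -` D) y :: ennreal)" for y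
      by (simp add: indicator_def)
    ultimately show "(\<integral>\<^sup>+y. indicator D (y, z) \<partial>lborel) = emeasure lborel ((\<lambda>y. (y, z)) -` D)"
      by simp
  qed
  also have "\<dots> = emeasure (lborel \<Otimes>\<^sub>M reduced) D"
    using D by (intro emeasure_pair_measure_alt2[symmetric]) (simp add: sets_eq)
  finally show "emeasure mean D = emeasure (lborel \<Otimes>\<^sub>M reduced) D" .
qed

text \<open>Difference 0 means x = y, so the atom counts the points in the unit cube.\<close>

lemma emeasure_reduced_zero: "emeasure reduced {0} = intensity M \<eta>"
  by (simp add: emeasure_reduced emeasure_mean Times_in_borel intensity_def emeasure_pair_kernel_diagonal)

text \<open>The condition that x and y be distinct says that y - x avoids 0, so alpha_2^! arises
  from \<open>reduced\<close> by deleting the atom at 0.\<close>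

lemma alpha2_eq:
  assumes [measurable]: "B \<in> sets borel"
  shows "alpha2 M \<eta> B = emeasure (density reduced (indicator (- {0}))) B"
proof -
  have sub: "(\<integral>\<^sup>+(x, y). indicator (cbox 0 One) x * indicator B (y - x)
        \<partial>count_space {(x, y). x \<in> \<eta> \<omega> \<and> y \<in> \<eta> \<omega> \<and> x \<noteq> y}) =
      emeasure (pair_kernel (\<eta> \<omega>)) (cbox 0 One \<times> (B - {0}))" for \<omega>
  proof -
    have "emeasure (pair_kernel (\<eta> \<omega>)) (cbox 0 One \<times> (B - {0})) =
        (\<integral>\<^sup>+p. indicator (cbox 0 One \<times> (B - {0})) p \<partial>pair_kernel (\<eta> \<omega>))"
      by (simp add: Times_in_borel)
    also have "\<dots> = (\<integral>\<^sup>+p. indicator (cbox 0 One \<times> (B - {0})) (fst p, snd p - fst p) \<partial>count_space (\<eta> \<omega> \<times> \<eta> \<omega>))"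
      by (rule nn_integral_pair_kernel) (auto intro!: borel_measurable_indicator Times_in_borel)
    also have "\<dots> = (\<integral>\<^sup>+p. indicator (cbox 0 One \<times> (B - {0})) (fst p, snd p - fst p)
        \<partial>count_space {(x, y). x \<in> \<eta> \<omega> \<and> y \<in> \<eta> \<omega> \<and> x \<noteq> y})"
      by (rule nn_integral_count_space_eq) auto
    also have "\<dots> = (\<integral>\<^sup>+(x, y). indicator (cbox 0 One) x * indicator B (y - x)
        \<partial>count_space {(x, y). x \<in> \<eta> \<omega> \<and> y \<in> \<eta> \<omega> \<and> x \<noteq> y})"
      by (rule nn_integral_cong) (auto simp: indicator_def)
    finally show ?thesis ..
  qed
  have "alpha2 M \<eta> B = emeasure reduced (B - {0})"
    by (simp add: alpha2_def sub emeasure_reduced emeasure_mean Times_in_borel)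
  also have "\<dots> = (\<integral>\<^sup>+z. indicator (- {0}) z * indicator B z \<partial>reduced)"
    by (simp flip: nn_integral_indicator) (auto intro!: nn_integral_cong simp: indicator_def)
  also have "\<dots> = emeasure (density reduced (indicator (- {0}))) B"
    by (simp add: emeasure_density)
  finally show ?thesis .
qed

end


section \<open>First and second moments of sums over the process\<close>

context square_integrable_stationary_process
begin

lemma nn_integral_mean_iterated:
  assumes [measurable]: "f \<in> borel_measurable borel"
  shows "(\<integral>\<^sup>+p. f p \<partial>mean) = (\<integral>\<^sup>+z. \<integral>\<^sup>+x. f (x, z) \<partial>lborel \<partial>reduced)"
proof -
  interpret r: sigma_finite_measure reduced by (rule sigma_finite_reduced)
  interpret pair_sigma_finite "lborel :: 'a measure" reduced ..
  have "f \<in> borel_measurable (lborel \<Otimes>\<^sub>M reduced)"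
    using assms unfolding borel_prod[symmetric] by (simp cong: measurable_cong_sets sets_pair_measure_cong)
  then show ?thesis
    unfolding mean_eq_pair_measure by (subst nn_integral_snd[symmetric]) auto
qed

lemma integral_mean_iterated:
  fixes F :: "'a \<times> 'a \<Rightarrow> complex"
  assumes "integrable mean F"
  shows "integrable reduced (\<lambda>z. \<integral>x. F (x, z) \<partial>lborel)"
    and "(\<integral>p. F p \<partial>mean) = (\<integral>z. \<integral>x. F (x, z) \<partial>lborel \<partial>reduced)"
proof -
  interpret r: sigma_finite_measure reduced by (rule sigma_finite_reduced)
  interpret pair_sigma_finite "lborel :: 'a measure" reduced ..
  have "integrable (lborel \<Otimes>\<^sub>M reduced) (case_prod (\<lambda>x z. F (x, z)))"
    using assms by (simp add: mean_eq_pair_measure)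
  note integrable_snd[OF this] integral_snd[OF this]
  then show "integrable reduced (\<lambda>z. \<integral>x. F (x, z) \<partial>lborel)"
    and "(\<integral>p. F p \<partial>mean) = (\<integral>z. \<integral>x. F (x, z) \<partial>lborel \<partial>reduced)"
    by (simp_all add: mean_eq_pair_measure)
qed

text \<open>The set function \<open>alpha2\<close> as an actual measure; the two agree on Borel sets
  by \<open>alpha2_eq\<close>.\<close>

definition factorial :: "'a measure" where
  "factorial = density reduced (indicator (- {0}))"

lemma sets_factorial [measurable_cong, simp]: "sets factorial = sets borel"
  by (simp add: factorial_def)

lemma emeasure_factorial_bounded:
  assumes "bounded B" "B \<in> sets borel"
  shows "emeasure factorial B < \<infinity>"
proof -
  have "emeasure factorial B = (\<integral>\<^sup>+z. indicator (- {0}) z * indicator B z \<partial>reduced)"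
    using assms(2) by (simp add: factorial_def emeasure_density)
  also have "\<dots> \<le> (\<integral>\<^sup>+z. indicator B z \<partial>reduced)"
    by (intro nn_integral_mono) (auto simp: indicator_def)
  also have "\<dots> < \<infinity>"
    using emeasure_reduced_bounded[OF assms] assms(2) by simp
  finally show ?thesis .
qed

text \<open>Separates the atom at 0, whose mass is the intensity, from the contribution of distinct
  points.\<close>

lemma nn_integral_reduced_split:
  assumes [measurable]: "f \<in> borel_measurable borel"
  shows "(\<integral>\<^sup>+z. f z \<partial>reduced) = intensity M \<eta> * f 0 + (\<integral>\<^sup>+z. f z \<partial>factorial)"
proof -
  have "(\<integral>\<^sup>+z. f z \<partial>reduced) = (\<integral>\<^sup>+z. f 0 * indicator {0} z + indicator (- {0}) z * f z \<partial>reduced)"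
    by (intro nn_integral_cong) (auto simp: indicator_def)
  also have "\<dots> = (\<integral>\<^sup>+z. f 0 * indicator {0} z \<partial>reduced) + (\<integral>\<^sup>+z. indicator (- {0}) z * f z \<partial>reduced)"
    by (rule nn_integral_add) measurable
  also have "(\<integral>\<^sup>+z. indicator (- {0}) z * f z \<partial>reduced) = (\<integral>\<^sup>+z. f z \<partial>factorial)"
    by (simp add: factorial_def nn_integral_density)
  finally show ?thesis
    by (simp add: nn_integral_cmult_indicator emeasure_reduced_zero mult.commute)
qed

lemma measure_reduced_zero: "measure reduced {0} = enn2real (intensity M \<eta>)"
  by (simp add: measure_def emeasure_reduced_zero)

lemma integral_reduced_split:
  fixes G :: "'a \<Rightarrow> complex"
  assumes G: "integrable reduced G"
  shows "integrable factorial G"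
    and "(\<integral>z. G z \<partial>reduced) = of_real (enn2real (intensity M \<eta>)) * G 0 + (\<integral>z. G z \<partial>factorial)"
proof -
  have [measurable]: "G \<in> borel_measurable borel"
    using G by (auto cong: measurable_cong_sets)
  have fin: "emeasure reduced {0} < \<infinity>"
    by (rule emeasure_reduced_bounded) auto
  have fact: "factorial = density reduced (\<lambda>z. ennreal (indicator (- {0}) z))"
    unfolding factorial_def by (intro arg_cong[where f = "density reduced"]) (auto simp: indicator_def fun_eq_iff)
  have int: "integrable reduced (\<lambda>z. indicator (- {0}) z *\<^sub>R G z)"
    by (rule Bochner_Integration.integrable_bound[OF G]) (auto simp: indicator_def)
  then show "integrable factorial G"
    unfolding fact by (subst integrable_density) auto
  have int0: "integrable reduced (\<lambda>z. indicator {0} z *\<^sub>R G 0)"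
    using fin by (intro integrable_real_indicator[THEN integrable_scaleR_left]) auto
  have "(\<integral>z. G z \<partial>reduced) = (\<integral>z. indicator {0} z *\<^sub>R G 0 + indicator (- {0}) z *\<^sub>R G z \<partial>reduced)"
    by (intro Bochner_Integration.integral_cong) (auto simp: indicator_def)
  also have "\<dots> = (\<integral>z. indicator {0} z *\<^sub>R G 0 \<partial>reduced) + (\<integral>z. indicator (- {0}) z *\<^sub>R G z \<partial>reduced)"
    by (rule Bochner_Integration.integral_add[OF int0 int])
  also have "(\<integral>z. indicator {0} z *\<^sub>R G 0 \<partial>reduced) = of_real (enn2real (intensity M \<eta>)) * G 0"
    using fin by (simp add: measure_reduced_zero scaleR_conv_of_real)
  also have "(\<integral>z. indicator (- {0}) z *\<^sub>R G z \<partial>reduced) = (\<integral>z. G z \<partial>factorial)"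
    unfolding fact by (subst integral_density) auto
  finally show "(\<integral>z. G z \<partial>reduced) = of_real (enn2real (intensity M \<eta>)) * G 0 + (\<integral>z. G z \<partial>factorial)" .
qed

lemma borel_measurable_diagonal:
  fixes f :: "'a \<Rightarrow> complex"
  assumes "f \<in> borel_measurable borel"
  shows "(\<lambda>p. f (fst p) * indicator {0} (snd p)) \<in> borel_measurable (borel :: ('a \<times> 'a) measure)"
  by (intro borel_measurable_times measurable_compose[OF measurable_fst_borel assms]
      measurable_compose[OF measurable_snd_borel borel_measurable_indicator] borel_closed[OF closed_singleton])

lemma measurable_infsum [measurable]:
  fixes f :: "'a \<Rightarrow> complex"
  assumes "f \<in> borel_measurable borel"
  shows "(\<lambda>\<omega>. infsum f (\<eta> \<omega>)) \<in> borel_measurable M"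
  unfolding infsum_eq_integral_pair_kernel(1)[OF assms]
  by (rule measurable_integral_kernel[OF borel_measurable_diagonal[OF assms]])

text \<open>A sum over single points is a sum over pairs weighted by the indicator of difference 0.
  In the product form of \<open>mean\<close> this weight sees only the atom of
  \<open>reduced\<close> at 0 and leaves the Lebesgue integral of f.\<close>

lemma campbell:
  fixes f :: "'a \<Rightarrow> complex"
  assumes f: "integrable lborel f"
  shows "AE \<omega> in M. Infinite_Set_Sum.abs_summable_on f (\<eta> \<omega>)"
    and "integrable M (\<lambda>\<omega>. infsum f (\<eta> \<omega>))"
    and "(\<integral>\<omega>. infsum f (\<eta> \<omega>) \<partial>M) = of_real (enn2real (intensity M \<eta>)) * (\<integral>x. f x \<partial>lborel)"
proof -
  have meas: "f \<in> borel_measurable borel" using f by auto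
  have [measurable]: "(\<lambda>p. norm (f (fst p) * indicator {0} (snd p))) \<in> borel_measurable (borel :: ('a \<times> 'a) measure)"
    using borel_measurable_diagonal[OF meas] by measurable
  let ?F = "\<lambda>p :: 'a \<times> 'a. f (fst p) * indicator {0} (snd p)"
  have "(\<integral>\<^sup>+p. norm (?F p) \<partial>mean) = (\<integral>\<^sup>+z. \<integral>\<^sup>+x. norm (?F (x, z)) \<partial>lborel \<partial>reduced)"
    by (rule nn_integral_mean_iterated) measurable
  also have "\<dots> = (\<integral>\<^sup>+z. (\<integral>\<^sup>+x. norm (f x) \<partial>lborel) * indicator {0} z \<partial>reduced)"
    by (intro nn_integral_cong) (auto simp: indicator_def)
  also have "\<dots> = (\<integral>\<^sup>+x. norm (f x) \<partial>lborel) * emeasure reduced {0}"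
    by (simp add: nn_integral_cmult_indicator)
  also have "\<dots> < \<infinity>"
    using f emeasure_reduced_bounded[of "{0}"] by (auto simp: integrable_iff_bounded ennreal_mult_less_top)
  finally have int: "integrable mean ?F"
    using borel_measurable_diagonal[OF meas] by (simp add: integrable_iff_bounded cong: measurable_cong_sets)
  show "AE \<omega> in M. Infinite_Set_Sum.abs_summable_on f (\<eta> \<omega>)"
    using AE_integrable_kernel[OF int] by (simp add: infsum_eq_integral_pair_kernel(2)[OF meas])
  show "integrable M (\<lambda>\<omega>. infsum f (\<eta> \<omega>))"
    unfolding infsum_eq_integral_pair_kernel(1)[OF meas] by (rule integral_mean(1)[OF int])
  have "(\<integral>\<omega>. infsum f (\<eta> \<omega>) \<partial>M) = (\<integral>p. ?F p \<partial>mean)"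
    unfolding infsum_eq_integral_pair_kernel(1)[OF meas] by (rule integral_mean(2)[OF int, symmetric])
  also have "\<dots> = (\<integral>z. \<integral>x. ?F (x, z) \<partial>lborel \<partial>reduced)"
    by (rule integral_mean_iterated(2)[OF int])
  also have "\<dots> = (\<integral>z. indicator {0} z *\<^sub>R (\<integral>x. f x \<partial>lborel) \<partial>reduced)"
    by (intro Bochner_Integration.integral_cong) (auto simp: indicator_def)
  also have "\<dots> = of_real (enn2real (intensity M \<eta>)) * (\<integral>x. f x \<partial>lborel)"
    using emeasure_reduced_bounded[of "{0}"] by (simp add: measure_reduced_zero scaleR_conv_of_real)
  finally show "(\<integral>\<omega>. infsum f (\<eta> \<omega>) \<partial>M) = of_real (enn2real (intensity M \<eta>)) * (\<integral>x. f x \<partial>lborel)" .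
qed

text \<open>In difference coordinates \<open>fst p + snd p\<close> is the second point of the pair.
  Almost surely both sums converge absolutely, by \<open>campbell\<close>, over a countable set;
  their product is then the sum over all ordered pairs, to which the mean measure applies.\<close>

lemma second_moment:
  fixes f g :: "'a \<Rightarrow> complex"
  assumes f: "integrable lborel f" and g: "integrable lborel g"
    and int: "integrable mean (\<lambda>p. f (fst p) * g (fst p + snd p))"
  shows "integrable M (\<lambda>\<omega>. infsum f (\<eta> \<omega>) * infsum g (\<eta> \<omega>))"
    and "(\<integral>\<omega>. infsum f (\<eta> \<omega>) * infsum g (\<eta> \<omega>) \<partial>M) = (\<integral>p. f (fst p) * g (fst p + snd p) \<partial>mean)"
proof -
  let ?F = "\<lambda>p. f (fst p) * g (fst p + snd p)"
  have [measurable]: "f \<in> borel_measurable borel" "g \<in> borel_measurable borel"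
    using f g by auto
  have meas: "?F \<in> borel_measurable borel"
    using int by (auto cong: measurable_cong_sets)
  have AE: "AE \<omega> in M. (\<integral>p. ?F p \<partial>pair_kernel (\<eta> \<omega>)) = infsum f (\<eta> \<omega>) * infsum g (\<eta> \<omega>)"
    using campbell(1)[OF f] campbell(1)[OF g] AE_space
  proof eventually_elim
    case (elim \<omega>)
    have "countable (\<eta> \<omega>)"
      using elim(3) by (intro countable_locally_finite locally_finite)
    then have "infsetsum (\<lambda>(x, y). f x * g y) (\<eta> \<omega> \<times> \<eta> \<omega>) = infsetsum f (\<eta> \<omega>) * infsetsum g (\<eta> \<omega>)"
      using elim(1,2) by (intro infsetsum_product)
    then show ?case
      using elim(1,2) by (simp add: integral_pair_kernel[OF meas] infsetsum_infsum case_prod_beta)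
  qed
  have meas_prod: "(\<lambda>\<omega>. infsum f (\<eta> \<omega>) * infsum g (\<eta> \<omega>)) \<in> borel_measurable M"
    by measurable
  show "integrable M (\<lambda>\<omega>. infsum f (\<eta> \<omega>) * infsum g (\<eta> \<omega>))"
    by (rule integrable_cong_AE_imp[OF integral_mean(1)[OF int] meas_prod]) (use AE in \<open>auto simp: eq_commute\<close>)
  have "(\<integral>p. ?F p \<partial>mean) = (\<integral>\<omega>. \<integral>p. ?F p \<partial>pair_kernel (\<eta> \<omega>) \<partial>M)"
    by (rule integral_mean(2)[OF int])
  also have "\<dots> = (\<integral>\<omega>. infsum f (\<eta> \<omega>) * infsum g (\<eta> \<omega>) \<partial>M)"
    by (rule integral_cong_AE) (use AE meas_prod measurable_integral_kernel[OF meas] in auto)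
  finally show "(\<integral>\<omega>. infsum f (\<eta> \<omega>) * infsum g (\<eta> \<omega>) \<partial>M) = (\<integral>p. ?F p \<partial>mean)" ..
qed

end


section \<open>Covariances when the total variation of beta_2^! is finite\<close>

locale short_range_process = square_integrable_stationary_process M \<eta>
  for M :: "'w measure" and \<eta> :: "'w \<Rightarrow> 'a::euclidean_space set" +
  fixes \<gamma> p :: real
  assumes intensity: "intensity M \<eta> = ennreal \<gamma>" and gamma_pos: "\<gamma> > 0"
    and short_range: "(\<integral>\<^sup>+x. ennreal (1 + norm x powr p) \<partial>total_variation (beta2 M \<eta>)) < \<infinity>"
begin

text \<open>Both parts, alpha_2^! and gamma^2 times Lebesgue measure, are finite on bounded sets,
  where their difference is \<open>beta2\<close> by definition.\<close>

sublocale beta: signed_local_measure factorial "density lborel (\<lambda>_. ennreal (\<gamma>\<^sup>2))" "beta2 M \<eta>"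
proof
  fix B :: "'a set" assume B: "bounded B" "B \<in> sets borel"
  show "emeasure factorial B < \<infinity>"
    using B by (rule emeasure_factorial_bounded)
  have eq: "emeasure (density lborel (\<lambda>_. ennreal (\<gamma>\<^sup>2))) B = ennreal (\<gamma>\<^sup>2) * emeasure lborel B"
    using B by (simp add: emeasure_density nn_integral_cmult_indicator)
  then show "emeasure (density lborel (\<lambda>_. ennreal (\<gamma>\<^sup>2))) B < \<infinity>"
    using emeasure_bounded_finite[OF B(1)] by (simp add: ennreal_mult_less_top)
  show "beta2 M \<eta> B = measure factorial B - measure (density lborel (\<lambda>_. ennreal (\<gamma>\<^sup>2))) B"
    using B gamma_pos eq
    by (simp add: beta2_def alpha2_eq factorial_def measure_def intensity enn2real_mult)
qed simp_all

lemmas finite_pos_variation = beta.finite_variations(1)[OF short_range]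
  and finite_neg_variation = beta.finite_variations(2)[OF short_range]

text \<open>Local square integrability bounds \<open>reduced\<close> on bounded sets only, so the
  tail needs an argument. The function \<open>G\<close> has Lebesgue integral equal to the product
  of the L^1 norms of f and g, and it is bounded by C times that of f, hence integrable for the
  finite positive variation. Together with the atom at 0 and
  \<open>beta.nn_integral_alpha_le\<close> this covers all of \<open>reduced\<close>.\<close>

lemma integrable_mean_product:
  fixes f g :: "'a \<Rightarrow> complex"
  assumes f: "integrable lborel f" and g: "integrable lborel g" and C: "\<And>x. norm (g x) \<le> C"
  shows "integrable mean (\<lambda>p. f (fst p) * g (fst p + snd p))"
proof -
  interpret P: finite_measure "pos_variation (beta2 M \<eta>)" by (rule finite_pos_variation)
  interpret lborel_pair: pair_sigma_finite "lborel :: 'a measure" "lborel :: 'a measure" ..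
  have [measurable]: "f \<in> borel_measurable borel" "g \<in> borel_measurable borel"
    using f g by auto
  have C0: "0 \<le> C" using norm_ge_zero C by (rule order_trans)
  have "(\<lambda>p. f (fst p) * g (fst p + snd p)) \<in> borel_measurable (borel \<Otimes>\<^sub>M borel)"
    by measurable
  then have meas [measurable]: "(\<lambda>p. f (fst p) * g (fst p + snd p)) \<in> borel_measurable (borel :: ('a \<times> 'a) measure)"
    by (simp add: borel_prod)
  define G where "G z = (\<integral>\<^sup>+x. ennreal (norm (f x)) * ennreal (norm (g (x + z))) \<partial>lborel)" for z
  have [measurable]: "G \<in> borel_measurable borel"
    unfolding G_def by measurable
  have fin: "(\<integral>\<^sup>+x. norm (f x) \<partial>lborel) < \<infinity>" "(\<integral>\<^sup>+x. norm (g x) \<partial>lborel) < \<infinity>"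
    using f g by (auto simp: integrable_iff_bounded)
  have bound: "G z \<le> (\<integral>\<^sup>+x. norm (f x) \<partial>lborel) * ennreal C" for z
    unfolding G_def by (subst nn_integral_multc[symmetric]) (auto intro!: nn_integral_mono mult_left_mono ennreal_leI C)
  have finC: "(\<integral>\<^sup>+x. norm (f x) \<partial>lborel) * ennreal C < \<infinity>"
    using fin by (simp add: ennreal_mult_less_top)
  have shift: "(\<integral>\<^sup>+z. ennreal (norm (g (x + z))) \<partial>lborel) = (\<integral>\<^sup>+z. norm (g z) \<partial>lborel)" for x
    using nn_integral_lborel_affine[of "\<lambda>z. ennreal (norm (g z))" 1 x] by simp
  have "(\<integral>\<^sup>+z. G z \<partial>lborel) =
      (\<integral>\<^sup>+x. \<integral>\<^sup>+z. ennreal (norm (f x)) * ennreal (norm (g (x + z))) \<partial>lborel \<partial>lborel)"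
    unfolding G_def by (rule lborel_pair.Fubini') measurable
  also have "\<dots> = (\<integral>\<^sup>+x. norm (f x) \<partial>lborel) * (\<integral>\<^sup>+z. norm (g z) \<partial>lborel)"
    by (simp add: nn_integral_cmult shift nn_integral_multc)
  finally have lborel: "(\<integral>\<^sup>+z. G z \<partial>lborel) < \<infinity>"
    using fin by (simp add: ennreal_mult_less_top)
  have "(\<integral>\<^sup>+z. G z \<partial>pos_variation (beta2 M \<eta>)) \<le>
      (\<integral>\<^sup>+z. (\<integral>\<^sup>+x. norm (f x) \<partial>lborel) * ennreal C \<partial>pos_variation (beta2 M \<eta>))"
    by (rule nn_integral_mono) (rule bound)
  also have "\<dots> < \<infinity>"
    using finC less_top[THEN iffD1, OF P.emeasure_finite, of UNIV] by (simp add: ennreal_mult_less_top)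
  finally have pos: "(\<integral>\<^sup>+z. G z \<partial>pos_variation (beta2 M \<eta>)) < \<infinity>" .
  have "(\<integral>\<^sup>+p. norm (f (fst p) * g (fst p + snd p)) \<partial>mean) =
      (\<integral>\<^sup>+z. \<integral>\<^sup>+x. norm (f x * g (x + z)) \<partial>lborel \<partial>reduced)"
    by (subst nn_integral_mean_iterated) simp_all
  also have "\<dots> = (\<integral>\<^sup>+z. G z \<partial>reduced)"
    by (simp add: G_def norm_mult ennreal_mult)
  also have "\<dots> = ennreal \<gamma> * G 0 + (\<integral>\<^sup>+z. G z \<partial>factorial)"
    by (simp add: nn_integral_reduced_split intensity)
  also have "\<dots> \<le> ennreal \<gamma> * G 0 + ((\<integral>\<^sup>+z. G z \<partial>density lborel (\<lambda>_. ennreal (\<gamma>\<^sup>2))) +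
      (\<integral>\<^sup>+z. G z \<partial>pos_variation (beta2 M \<eta>)))"
    by (intro add_left_mono beta.nn_integral_alpha_le) measurable
  also have "\<dots> < \<infinity>"
    using le_less_trans[OF bound finC, of 0] lborel pos
    by (simp add: nn_integral_density nn_integral_cmult ennreal_mult_less_top)
  finally show ?thesis
    using meas by (simp add: integrable_iff_bounded cong: measurable_cong_sets)
qed

text \<open>The centering constants c and d are left free so that one formula serves the amplitude
  at wave vector 0, which is centered at its mean, and those at other wave vectors, which are not
  centered.\<close>

lemma covariance:
  fixes f g :: "'a \<Rightarrow> complex" and c d :: complex
  assumes f: "integrable lborel f" and g: "integrable lborel g" and C: "\<And>x. norm (g x) \<le> C"
  shows "integrable M (\<lambda>\<omega>. (infsum f (\<eta> \<omega>) - c) * (infsum g (\<eta> \<omega>) - d))"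
    and "(\<integral>\<omega>. (infsum f (\<eta> \<omega>) - c) * (infsum g (\<eta> \<omega>) - d) \<partial>M) =
      of_real \<gamma> * (\<integral>x. f x * g x \<partial>lborel) +
      signed_integral (beta2 M \<eta>) (\<lambda>z. \<integral>x. f x * g (x + z) \<partial>lborel) +
      (of_real \<gamma> * (\<integral>x. f x \<partial>lborel) - c) * (of_real \<gamma> * (\<integral>x. g x \<partial>lborel) - d)"
proof -
  interpret prob_space M by (rule prob_space)
  interpret lborel_pair: pair_sigma_finite "lborel :: 'a measure" "lborel :: 'a measure" ..
  have [measurable]: "f \<in> borel_measurable borel" "g \<in> borel_measurable borel"
    using f g by auto
  let ?S = "\<lambda>\<omega>. infsum f (\<eta> \<omega>)" and ?T = "\<lambda>\<omega>. infsum g (\<eta> \<omega>)"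
  define G where "G z = (\<integral>x. f x * g (x + z) \<partial>lborel)" for z
  note int = integrable_mean_product[OF f g C]
  note ints = second_moment(1)[OF f g int] campbell(2)[OF f] campbell(2)[OF g]
  have expand: "(?S \<omega> - c) * (?T \<omega> - d) = ?S \<omega> * ?T \<omega> - d * ?S \<omega> - c * ?T \<omega> + c * d" for \<omega>
    by (simp add: algebra_simps)
  show "integrable M (\<lambda>\<omega>. (?S \<omega> - c) * (?T \<omega> - d))"
    unfolding expand using ints by simp
  \<comment> \<open>Translation preserves the L^1 norm of g, so the product is jointly integrable;
    Fubini then factors the Lebesgue integral of \<open>G\<close>.\<close>
  have pair: "integrable (lborel \<Otimes>\<^sub>M lborel) (\<lambda>(x, z). f x * g (x + z))"
  proof (rule lborel_pair.Fubini_integrable)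
    show "(\<lambda>(x, z). f x * g (x + z)) \<in> borel_measurable (lborel \<Otimes>\<^sub>M lborel)"
      by measurable
    have "(\<integral>z. norm (g (x + z)) \<partial>lborel) = (\<integral>z. norm (g z) \<partial>lborel)" for x
      using lborel_integral_affine[of "\<lambda>z. norm (g z)" 1 x] by simp
    then show "integrable lborel (\<lambda>x. \<integral>z. norm (case (x, z) of (x, z) \<Rightarrow> f x * g (x + z)) \<partial>lborel)"
      using f by (simp add: norm_mult)
    show "AE x in lborel. integrable lborel (\<lambda>z. case (x, z) of (x, z) \<Rightarrow> f x * g (x + z))"
      using lborel_integrable_affine[OF g, of 1] by simp
  qed
  have intG: "integrable lborel G" "(\<integral>z. G z \<partial>lborel) = (\<integral>x. f x \<partial>lborel) * (\<integral>x. g x \<partial>lborel)"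
  proof -
    show "integrable lborel G"
      unfolding G_def by (rule lborel_pair.integrable_snd[OF pair])
    have shift: "(\<integral>z. g (x + z) \<partial>lborel) = (\<integral>z. g z \<partial>lborel)" for x
      using lborel_integral_affine[of g 1 x] by simp
    have "(\<integral>z. G z \<partial>lborel) = (\<integral>x. \<integral>z. f x * g (x + z) \<partial>lborel \<partial>lborel)"
      unfolding G_def by (rule lborel_pair.Fubini_integral[OF pair])
    then show "(\<integral>z. G z \<partial>lborel) = (\<integral>x. f x \<partial>lborel) * (\<integral>x. g x \<partial>lborel)"
      by (simp add: shift)
  qed
  have red: "integrable reduced G" "(\<integral>p. f (fst p) * g (fst p + snd p) \<partial>mean) = (\<integral>z. G z \<partial>reduced)"
    using integral_mean_iterated[OF int] by (simp_all add: G_def[abs_def])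
  have dens: "integrable (density lborel (\<lambda>_. ennreal (\<gamma>\<^sup>2))) G"
    "(\<integral>z. G z \<partial>density lborel (\<lambda>_. ennreal (\<gamma>\<^sup>2))) = of_real (\<gamma>\<^sup>2) * (\<integral>z. G z \<partial>lborel)"
    using intG(1) by (simp_all add: integrable_density integral_density scaleR_conv_of_real)
  have "signed_integral (beta2 M \<eta>) G = (\<integral>z. G z \<partial>factorial) - of_real (\<gamma>\<^sup>2) * (\<integral>z. G z \<partial>lborel)"
    using beta.signed_integral_eq[OF integral_reduced_split(1)[OF red(1)] dens(1)] dens(2) by simp
  then have ST: "(\<integral>\<omega>. ?S \<omega> * ?T \<omega> \<partial>M) = of_real \<gamma> * (\<integral>x. f x * g x \<partial>lborel) +
      signed_integral (beta2 M \<eta>) G + of_real (\<gamma>\<^sup>2) * ((\<integral>x. f x \<partial>lborel) * (\<integral>x. g x \<partial>lborel))"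
    using integral_reduced_split(2)[OF red(1)] gamma_pos
    by (simp add: second_moment(2)[OF f g int] red(2) intG(2) intensity) (simp add: G_def)
  have "(\<integral>\<omega>. (?S \<omega> - c) * (?T \<omega> - d) \<partial>M) =
      (\<integral>\<omega>. ?S \<omega> * ?T \<omega> \<partial>M) - d * (\<integral>\<omega>. ?S \<omega> \<partial>M) - c * (\<integral>\<omega>. ?T \<omega> \<partial>M) + c * d"
    unfolding expand using ints by (simp add: prob_space)
  \<comment> \<open>The Lebesgue part of the second moment contributes gamma^2 times the product of
    the two integrals, exactly the term that makes the means and constants factor into a
    product.\<close>
  also have "\<dots> = of_real \<gamma> * (\<integral>x. f x * g x \<partial>lborel) + signed_integral (beta2 M \<eta>) G +
      (of_real \<gamma> * (\<integral>x. f x \<partial>lborel) - c) * (of_real \<gamma> * (\<integral>x. g x \<partial>lborel) - d)"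
    using gamma_pos unfolding ST campbell(3)[OF f] campbell(3)[OF g] intensity
    by (simp add: algebra_simps power2_eq_square)
  finally show "(\<integral>\<omega>. (?S \<omega> - c) * (?T \<omega> - d) \<partial>M) = of_real \<gamma> * (\<integral>x. f x * g x \<partial>lborel) +
      signed_integral (beta2 M \<eta>) (\<lambda>z. \<integral>x. f x * g (x + z) \<partial>lborel) +
      (of_real \<gamma> * (\<integral>x. f x \<partial>lborel) - c) * (of_real \<gamma> * (\<integral>x. g x \<partial>lborel) - d)"
    unfolding G_def .
qed

end


section \<open>Correlations of tapers\<close>

text \<open>Keeps two features of h: an upper bound and L^1 continuity of translations at 0. The
  limit is along \<open>nhds 0\<close> rather than a punctured neighbourhood, so it composes with
  shifts such as z/r that may vanish.\<close>

locale taper =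
  fixes h :: "'a::euclidean_space \<Rightarrow> real" and C :: real
  assumes measurable_taper [measurable]: "h \<in> borel_measurable borel"
    and nonneg: "0 \<le> h x" and le_bound: "h x \<le> C"
    and integrable_taper: "integrable lborel h"
    and modulus_tendsto_0: "((\<lambda>w. \<integral>x. \<bar>h (x + w) - h x\<bar> \<partial>lborel) \<longlongrightarrow> 0) (nhds 0)"
begin

definition modulus :: "'a \<Rightarrow> real" where
  "modulus w = (\<integral>x. \<bar>h (x + w) - h x\<bar> \<partial>lborel)"

text \<open>Up to a phase, the inner integral of the rescaled covariance at shift w = z/r and
  frequency \<xi> = r(l - k).\<close>

definition correlation :: "'a \<Rightarrow> 'a \<Rightarrow> complex" where
  "correlation w \<xi> = (\<integral>x. of_real (h x * h (x + w)) * exp (\<i> * of_real (\<xi> \<bullet> x)) \<partial>lborel)"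

lemma bound_nonneg: "0 \<le> C"
  using nonneg[of 0] le_bound[of 0] by simp

lemma integrable_translate: "integrable lborel (\<lambda>x. h (x + w))"
  using lborel_integrable_affine[OF integrable_taper, of 1 w] by (simp add: add.commute)

lemma integrable_product: "integrable lborel (\<lambda>x. h x * h (x + w))"
proof (rule Bochner_Integration.integrable_bound)
  show "integrable lborel (\<lambda>x. h x * C)"
    using integrable_taper by simp
  show "AE x in lborel. norm (h x * h (x + w)) \<le> norm (h x * C)"
    using nonneg le_bound bound_nonneg by (auto intro!: mult_left_mono simp: abs_mult)
qed measurable

lemma integrable_correlation:
  "integrable lborel (\<lambda>x. complex_of_real (h x * h (x + w)) * exp (\<i> * of_real (\<xi> \<bullet> x)))"
proof (rule Bochner_Integration.integrable_bound[OF integrable_product[of w]])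
  show "AE x in lborel. norm (complex_of_real (h x * h (x + w)) * exp (\<i> * of_real (\<xi> \<bullet> x)))
      \<le> norm (h x * h (x + w))"
    by (auto simp: norm_mult)
qed measurable

lemma integrable_modulus: "integrable lborel (\<lambda>x. \<bar>h (x + w) - h x\<bar>)"
  using integrable_translate[of w] integrable_taper by auto

lemma norm_correlation_le: "norm (correlation w \<xi>) \<le> C * (\<integral>x. h x \<partial>lborel)"
proof -
  have "norm (correlation w \<xi>) \<le> (\<integral>x. norm (complex_of_real (h x * h (x + w)) * exp (\<i> * of_real (\<xi> \<bullet> x))) \<partial>lborel)"
    unfolding correlation_def by (rule integral_norm_bound)
  also have "\<dots> \<le> (\<integral>x. C * h x \<partial>lborel)"
  proof (rule integral_mono)
    show "integrable lborel (\<lambda>x. norm (complex_of_real (h x * h (x + w)) * exp (\<i> * of_real (\<xi> \<bullet> x))))"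
      using integrable_correlation by (rule integrable_norm)
    show "norm (complex_of_real (h x * h (x + w)) * exp (\<i> * of_real (\<xi> \<bullet> x))) \<le> C * h x" for x
      using mult_left_mono[OF le_bound[of "x + w"] nonneg[of x]] nonneg
      by (simp add: norm_mult mult.commute)
  qed (use integrable_taper in simp)
  finally show ?thesis by simp
qed

text \<open>The common factor h(x) is at most \<open>C\<close> and the exponential has modulus 1.
  The bound does not depend on \<xi>, so the shift may be dropped even while the frequency
  diverges.\<close>

lemma norm_correlation_diff_le: "norm (correlation w \<xi> - correlation 0 \<xi>) \<le> C * modulus w"
proof -
  let ?f = "\<lambda>x. complex_of_real (h x * h (x + w)) * exp (\<i> * of_real (\<xi> \<bullet> x)) -
    complex_of_real (h x * h (x + 0)) * exp (\<i> * of_real (\<xi> \<bullet> x))"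
  have int: "integrable lborel ?f"
    by (intro Bochner_Integration.integrable_diff integrable_correlation)
  have "correlation w \<xi> - correlation 0 \<xi> = (\<integral>x. ?f x \<partial>lborel)"
    unfolding correlation_def by (rule Bochner_Integration.integral_diff[symmetric]) (rule integrable_correlation)+
  then have "norm (correlation w \<xi> - correlation 0 \<xi>) \<le> (\<integral>x. norm (?f x) \<partial>lborel)"
    by (simp only: integral_norm_bound)
  also have "\<dots> \<le> (\<integral>x. C * \<bar>h (x + w) - h x\<bar> \<partial>lborel)"
  proof (rule integral_mono)
    show "integrable lborel (\<lambda>x. norm (?f x))"
      using int by (rule integrable_norm)
    show "integrable lborel (\<lambda>x. C * \<bar>h (x + w) - h x\<bar>)"
      using integrable_modulus by simp
    fix x
    have eq: "?f x = complex_of_real (h x * (h (x + w) - h x)) * exp (\<i> * of_real (\<xi> \<bullet> x))"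
      by (simp add: algebra_simps)
    have "norm (?f x) = h x * \<bar>h (x + w) - h x\<bar>"
      unfolding eq by (simp only: norm_mult norm_of_real norm_exp_i_times abs_mult) (simp add: nonneg)
    also have "\<dots> \<le> C * \<bar>h (x + w) - h x\<bar>"
      using le_bound[of x] by (intro mult_right_mono) auto
    finally show "norm (?f x) \<le> C * \<bar>h (x + w) - h x\<bar>" .
  qed
  finally show ?thesis by (simp add: modulus_def)
qed

text \<open>Translating by \<open>w = \<pi>\<xi>/|\<xi>|\<^sup>2\<close> changes the sign of the exponential; averaging the two
  expressions for the integral gives the Riemann-Lebesgue lemma with an explicit rate.\<close>
lemma riemann_lebesgue:
  assumes "\<xi> \<noteq> 0"
  shows "norm (correlation 0 \<xi>) \<le> C * modulus ((pi / (norm \<xi>)\<^sup>2) *\<^sub>R \<xi>)"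
proof -
  define w where "w = (pi / (norm \<xi>)\<^sup>2) *\<^sub>R \<xi>"
  have "\<xi> \<bullet> w = pi"
    using assms by (simp add: w_def power2_norm_eq_inner)
  then have exp_eq: "exp (\<i> * of_real (\<xi> \<bullet> (w + x))) = - exp (\<i> * of_real (\<xi> \<bullet> x))" for x
    by (simp add: inner_add_right distrib_left exp_add)
  let ?e = "\<lambda>x. exp (\<i> * of_real (\<xi> \<bullet> x))"
  let ?q = "\<lambda>x. complex_of_real (h x * h x) * ?e x"
  have q: "integrable lborel ?q"
    using integrable_correlation[of 0 \<xi>] by simp
  have q': "integrable lborel (\<lambda>x. ?q (w + x))"
    using lborel_integrable_affine[OF q, of 1 w] by simp
  have "correlation 0 \<xi> = (\<integral>x. ?q x \<partial>lborel)"
    by (simp add: correlation_def)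
  moreover have "(\<integral>x. ?q x \<partial>lborel) = (\<integral>x. ?q (w + x) \<partial>lborel)"
    using lborel_integral_affine[of ?q 1 w] by simp
  ultimately have "2 * correlation 0 \<xi> = (\<integral>x. ?q x + ?q (w + x) \<partial>lborel)"
    using q q' by (subst Bochner_Integration.integral_add) auto
  then have "2 * norm (correlation 0 \<xi>) \<le> (\<integral>x. norm (?q x + ?q (w + x)) \<partial>lborel)"
    using integral_norm_bound[of lborel "\<lambda>x. ?q x + ?q (w + x)"] by (simp only: norm_mult norm_numeral flip: \<open>2 * correlation 0 \<xi> = _\<close>)
  also have "\<dots> \<le> (\<integral>x. 2 * C * \<bar>h (x + w) - h x\<bar> \<partial>lborel)"
  proof (rule integral_mono)
    show "integrable lborel (\<lambda>x. norm (?q x + ?q (w + x)))"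
      using q q' by (intro integrable_norm Bochner_Integration.integrable_add)
    show "integrable lborel (\<lambda>x. 2 * C * \<bar>h (x + w) - h x\<bar>)"
      using integrable_modulus by simp
    fix x
    \<comment> \<open>The sign flip leaves a difference of squares, h(x)^2 - h(x + w)^2. Its factor
      h(x) + h(x + w) is at most 2C, and this 2 cancels the one from averaging.\<close>
    have eq: "?q x + ?q (w + x) = complex_of_real ((h x + h (x + w)) * (h x - h (x + w))) * ?e x"
      unfolding exp_eq by (simp add: algebra_simps)
    have "norm (?q x + ?q (w + x)) = (h x + h (x + w)) * \<bar>h (x + w) - h x\<bar>"
      unfolding eq by (simp only: norm_mult norm_of_real norm_exp_i_times abs_mult)
        (simp add: nonneg abs_minus_commute)
    also have "\<dots> \<le> 2 * C * \<bar>h (x + w) - h x\<bar>"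
      using le_bound[of x] le_bound[of "x + w"] by (intro mult_right_mono) auto
    finally show "norm (?q x + ?q (w + x)) \<le> 2 * C * \<bar>h (x + w) - h x\<bar>" .
  qed
  finally show ?thesis
    by (simp add: modulus_def w_def)
qed

lemma measurable_correlation [measurable]: "(\<lambda>w. correlation w \<xi>) \<in> borel_measurable borel"
  unfolding correlation_def by measurable

lemma modulus_compose_tendsto_0:
  assumes "(w \<longlongrightarrow> 0) F"
  shows "((\<lambda>r. C * modulus (w r)) \<longlongrightarrow> 0) F"
  using tendsto_mult_left[OF filterlim_compose[OF modulus_tendsto_0 assms], of C]
  by (simp add: modulus_def)

lemma correlation_0_0: "correlation 0 0 = of_real (taper_moment 2 h)"
  by (simp add: correlation_def taper_moment_def power2_eq_square flip: of_real_mult)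

lemma correlation_tendsto_moment:
  "((\<lambda>r. correlation (z /\<^sub>R r) 0) \<longlongrightarrow> of_real (taper_moment 2 h)) at_top"
proof -
  have "((\<lambda>r::real. z /\<^sub>R r) \<longlongrightarrow> 0) at_top"
    using tendsto_scaleR[OF tendsto_inverse_0_at_top[OF filterlim_ident] tendsto_const, of z] by simp
  then have "((\<lambda>r. correlation (z /\<^sub>R r) 0 - correlation 0 0) \<longlongrightarrow> 0) at_top"
    by (rule Lim_null_comparison[OF always_eventually[OF allI[OF norm_correlation_diff_le]] modulus_compose_tendsto_0])
  then show ?thesis
    by (simp add: LIM_zero_iff correlation_0_0)
qed

lemma correlation_tendsto_0:
  assumes \<xi>: "filterlim (\<lambda>r. norm (\<xi> r)) at_top at_top"
  shows "((\<lambda>r. correlation (z /\<^sub>R r) (\<xi> r)) \<longlongrightarrow> 0) at_top"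
proof -
  define w where "w r = (pi / (norm (\<xi> r))\<^sup>2) *\<^sub>R \<xi> r" for r
  have nonzero: "eventually (\<lambda>r. \<xi> r \<noteq> 0) at_top"
    using filterlim_at_top_dense[THEN iffD1, OF \<xi>, rule_format, of 0] by eventually_elim auto
  \<comment> \<open>The half-period shift \<open>w r\<close> has norm pi divided by the norm of
    \<open>\<xi> r\<close>.\<close>
  have "((\<lambda>r. pi * inverse (norm (\<xi> r))) \<longlongrightarrow> 0) at_top"
    using tendsto_mult_left[OF tendsto_inverse_0_at_top[OF \<xi>], of pi] by simp
  then have "((\<lambda>r. norm (w r)) \<longlongrightarrow> 0) at_top"
    by (rule Lim_transform_eventually)
      (use nonzero in eventually_elim, simp add: w_def power2_eq_square field_simps)
  then have w: "(w \<longlongrightarrow> 0) at_top"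
    by (rule tendsto_norm_zero_cancel)
  have "((\<lambda>r::real. z /\<^sub>R r) \<longlongrightarrow> 0) at_top"
    using tendsto_scaleR[OF tendsto_inverse_0_at_top[OF filterlim_ident] tendsto_const, of z] by simp
  then have lim: "((\<lambda>r. C * modulus (z /\<^sub>R r) + C * modulus (w r)) \<longlongrightarrow> 0) at_top"
    by (intro tendsto_add_zero modulus_compose_tendsto_0 w)
  have "eventually (\<lambda>r. norm (correlation (z /\<^sub>R r) (\<xi> r)) \<le> C * modulus (z /\<^sub>R r) + C * modulus (w r)) at_top"
    using nonzero
  proof eventually_elim
    case (elim r)
    have "norm (correlation (z /\<^sub>R r) (\<xi> r)) \<le> norm (correlation 0 (\<xi> r)) +
        norm (correlation (z /\<^sub>R r) (\<xi> r) - correlation 0 (\<xi> r))"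
      by (rule norm_triangle_sub)
    also have "\<dots> \<le> C * modulus (w r) + C * modulus (z /\<^sub>R r)"
      unfolding w_def by (intro add_mono riemann_lebesgue norm_correlation_diff_le elim)
    finally show ?case by (simp only: add.commute)
  qed
  then show ?thesis
    by (rule Lim_null_comparison[OF _ lim])
qed

end

text \<open>Near 0 the defining inequality bounds the L^1 modulus by a |y|^p, which tends to 0
  because p is positive.\<close>

lemma taper_class_imp_taper:
  assumes h: "h \<in> taper_class p" and "p > 0"
  obtains C where "taper h C"
proof -
  obtain a b where ab: "a > 0" "b > 0"
      "\<And>y. of_bool (norm y \<le> b) * (\<integral>x. \<bar>h (x + y) - h x\<bar> \<partial>lborel) \<le> a * norm y powr p"
    using h unfolding taper_class_def by blast
  obtain C where C: "\<And>x. norm (h x) \<le> C"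
    using h unfolding taper_class_def bounded_iff by blast
  have "((\<lambda>y. norm y powr p) \<longlongrightarrow> 0 powr p) (nhds (0::'a))"
    using \<open>p > 0\<close> by (intro tendsto_powr' tendsto_norm_zero filterlim_ident tendsto_const) auto
  then have "((\<lambda>y. a * norm y powr p) \<longlongrightarrow> 0) (nhds (0::'a))"
    using tendsto_mult_left[of "\<lambda>y. norm y powr p" 0 "nhds (0::'a)" a] by simp
  moreover have "eventually (\<lambda>y::'a. norm y \<le> b) (nhds 0)"
    using eventually_nhds_ball[OF ab(2), of "0::'a"] by eventually_elim (simp add: dist_norm)
  then have "eventually (\<lambda>y. norm (\<integral>x. \<bar>h (x + y) - h x\<bar> \<partial>lborel) \<le> a * norm y powr p) (nhds 0)"
  proof eventually_elim
    case (elim y)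
    then show ?case using ab(3)[of y] by simp
  qed
  ultimately have "((\<lambda>y. \<integral>x. \<bar>h (x + y) - h x\<bar> \<partial>lborel) \<longlongrightarrow> 0) (nhds 0)"
    by (rule Lim_null_comparison[rotated])
  then have "taper h C"
    using h C by unfold_locales (auto simp: taper_class_def abs_le_iff)
  then show ?thesis by (rule that)
qed


section \<open>Scattering amplitudes\<close>

context short_range_process
begin

text \<open>Dominated convergence on each Jordan part; the constant \<open>B\<close> is an
  integrable majorant because both parts are finite measures.\<close>

lemma signed_integral_tendsto:
  fixes G :: "real \<Rightarrow> 'a \<Rightarrow> complex"
  assumes [measurable]: "\<And>r. G r \<in> borel_measurable borel" "g \<in> borel_measurable borel"
    and lim: "\<And>z. ((\<lambda>r. G r z) \<longlongrightarrow> g z) at_top"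
    and bound: "\<And>r z. norm (G r z) \<le> B"
  shows "((\<lambda>r. signed_integral (beta2 M \<eta>) (G r)) \<longlongrightarrow> signed_integral (beta2 M \<eta>) g) at_top"
proof -
  have "((\<lambda>r. \<integral>z. G r z \<partial>V) \<longlongrightarrow> (\<integral>z. g z \<partial>V)) at_top"
    if [measurable_cong]: "sets V = sets borel" and "finite_measure V" for V :: "'a measure"
  proof -
    interpret finite_measure V by fact
    show ?thesis
      by (rule integral_dominated_convergence_at_top[where w = "\<lambda>_. B"])
        (use lim bound in auto)
  qed
  moreover have "sets (neg_variation (beta2 M \<eta>)) = sets borel"
    unfolding neg_variation_def by (rule signed_local_measure.sets_pos_variation[OF beta.swap])
  ultimately show ?thesis
    unfolding signed_integral_def
    by (intro tendsto_diff) (use finite_pos_variation finite_neg_variation in simp_all)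
qed

lemma scatter_cross_moment:
  fixes h :: "'a \<Rightarrow> real" and k l :: 'a
  assumes "taper h C" and r: "r > 0"
  defines "a \<equiv> complex_of_real (r powr (- (real DIM('a) / 2)))"
    and "c \<equiv> \<lambda>k :: 'a. of_bool (k = 0) * complex_of_real (taper_moment 1 h * \<gamma> * r powr (real DIM('a) / 2))"
  shows "integrable M (\<lambda>\<omega>. scatter M \<eta> h r k \<omega> * cnj (scatter M \<eta> h r l \<omega>))"
    and "(\<integral>\<omega>. scatter M \<eta> h r k \<omega> * cnj (scatter M \<eta> h r l \<omega>) \<partial>M) =
      of_real \<gamma> * taper.correlation h 0 (r *\<^sub>R (l - k)) +
      signed_integral (beta2 M \<eta>)
        (\<lambda>z. exp (- \<i> * of_real (k \<bullet> z)) * taper.correlation h (z /\<^sub>R r) (r *\<^sub>R (l - k))) +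
      (of_real \<gamma> * (a * (\<integral>x. of_real (scaled h r x) * exp (\<i> * of_real (l \<bullet> x)) \<partial>lborel)) - c l) *
      (of_real \<gamma> * (a * (\<integral>x. of_real (scaled h r x) * exp (- \<i> * of_real (k \<bullet> x)) \<partial>lborel)) - c k)"
proof -
  interpret taper h C by fact
  \<comment> \<open>The conjugated summand, belonging to l, is taken as the first factor of
    \<open>covariance\<close>. The shift z then falls on the exponential of k and splits off the
    phase exp(-i<k, z>) of the structure factor, while the remaining exponents combine to the
    frequency r(l - k).\<close>
  define f where "f x = a * (of_real (scaled h r x) * exp (\<i> * of_real (l \<bullet> x)))" for x
  define g where "g x = a * (of_real (scaled h r x) * exp (- \<i> * of_real (k \<bullet> x)))" for x
  have a: "1 / complex_of_real (r powr (real DIM('a) / 2)) = a" "cnj a = a"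
    by (simp_all add: a_def powr_minus_divide)
  \<comment> \<open>The two normalizations r^(-d/2) cancel the Jacobian r^d of the substitution x =
    r u.\<close>
  have aa: "of_real (r ^ DIM('a)) * (a * a) = 1"
    using r by (simp add: a_def powr_realpow[symmetric] flip: of_real_mult powr_add)
  have scatter_k: "scatter M \<eta> h r k \<omega> = infsum g (\<eta> \<omega>) - c k" for \<omega>
    using gamma_pos by (simp add: scatter_def g_def[abs_def] a c_def intensity infsum_cmult_right')
  have "cnj (scatter M \<eta> h r l \<omega>) = a * (\<Sum>\<^sub>\<infinity>x\<in>\<eta> \<omega>. cnj (of_real (scaled h r x) * exp (- \<i> * of_real (l \<bullet> x)))) - c l" for \<omega>
    using gamma_pos by (simp add: scatter_def a c_def intensity infsum_cnj del: complex_cnj_mult)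
      (simp add: a)
  then have scatter_l: "cnj (scatter M \<eta> h r l \<omega>) = infsum f (\<eta> \<omega>) - c l" for \<omega>
    by (simp add: f_def[abs_def] infsum_cmult_right' exp_cnj)
  have int: "integrable lborel (scaled h r)"
    using lborel_integrable_affine[OF integrable_taper, of "inverse r" 0] r by (simp add: scaled_def[abs_def])
  then have [measurable]: "scaled h r \<in> borel_measurable borel"
    by auto
  have "integrable lborel (\<lambda>x. a * (of_real (scaled h r x) * exp (\<i> * of_real (v \<bullet> x))))" for v :: 'a
    by (rule integrable_mult_right, rule Bochner_Integration.integrable_bound[OF int])
      (measurable, simp add: norm_mult)
  from this[of l] this[of "- k"] have fg: "integrable lborel f" "integrable lborel g"
    by (simp_all add: f_def[abs_def] g_def[abs_def])
  have gC: "norm (g x) \<le> norm a * C" for x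
    using nonneg[of "x /\<^sub>R r"] le_bound[of "x /\<^sub>R r"]
    by (auto simp: g_def norm_mult scaled_def intro!: mult_left_mono)
  have G: "(\<integral>x. f x * g (x + z) \<partial>lborel) =
      exp (- \<i> * of_real (k \<bullet> z)) * correlation (z /\<^sub>R r) (r *\<^sub>R (l - k))" for z
  proof -
    let ?E = "exp (- \<i> * of_real (k \<bullet> z))"
    have meas: "(\<lambda>x. f x * g (x + z)) \<in> borel_measurable borel"
      using fg by (auto intro!: borel_measurable_times measurable_compose[OF _ borel_measurable_integrable])
    have "f (r *\<^sub>R u) * g (r *\<^sub>R u + z) =
        (a * a) * (?E * (of_real (h u * h (u + z /\<^sub>R r)) * exp (\<i> * of_real ((r *\<^sub>R (l - k)) \<bullet> u))))" for u
    proof -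
      have "\<i> * of_real (l \<bullet> (r *\<^sub>R u)) + (- \<i> * of_real (k \<bullet> (r *\<^sub>R u + z))) =
          - \<i> * of_real (k \<bullet> z) + \<i> * complex_of_real ((r *\<^sub>R (l - k)) \<bullet> u)"
        by (simp add: inner_add_right inner_diff_left algebra_simps)
      then have exp_eq: "exp (\<i> * of_real (l \<bullet> (r *\<^sub>R u))) * exp (- \<i> * of_real (k \<bullet> (r *\<^sub>R u + z))) =
          ?E * exp (\<i> * of_real ((r *\<^sub>R (l - k)) \<bullet> u))"
        by (simp only: exp_add[symmetric])
      have "(r *\<^sub>R u) /\<^sub>R r = u" "(r *\<^sub>R u + z) /\<^sub>R r = u + z /\<^sub>R r"
        using r by (simp_all add: scaleR_add_right)
      then have "f (r *\<^sub>R u) * g (r *\<^sub>R u + z) = (a * a) * of_real (h u * h (u + z /\<^sub>R r)) *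
          (exp (\<i> * of_real (l \<bullet> (r *\<^sub>R u))) * exp (- \<i> * of_real (k \<bullet> (r *\<^sub>R u + z))))"
        by (simp only: f_def g_def scaled_def of_real_mult mult_ac)
      then show ?thesis
        by (simp only: exp_eq mult_ac)
    qed
    moreover have "(\<integral>x. f x * g (x + z) \<partial>lborel) = of_real (r ^ DIM('a)) * (\<integral>u. f (r *\<^sub>R u) * g (r *\<^sub>R u + z) \<partial>lborel)"
      using lborel_integral_affine[OF meas, of r 0] r by (simp add: scaleR_conv_of_real)
    ultimately have "(\<integral>x. f x * g (x + z) \<partial>lborel) =
        (of_real (r ^ DIM('a)) * (a * a)) * (?E * correlation (z /\<^sub>R r) (r *\<^sub>R (l - k)))"
      by (simp only: integral_mult_right_zero correlation_def mult.assoc)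
    then show ?thesis
      by (simp only: aa mult_1_left)
  qed
  have G0: "(\<integral>x. f x * g x \<partial>lborel) = correlation 0 (r *\<^sub>R (l - k))"
    using G[of 0] by simp
  have eq: "scatter M \<eta> h r k \<omega> * cnj (scatter M \<eta> h r l \<omega>) =
      (infsum f (\<eta> \<omega>) - c l) * (infsum g (\<eta> \<omega>) - c k)" for \<omega>
    unfolding scatter_k scatter_l by (rule mult.commute)
  show "integrable M (\<lambda>\<omega>. scatter M \<eta> h r k \<omega> * cnj (scatter M \<eta> h r l \<omega>))"
    unfolding eq by (rule covariance(1)[OF fg gC])
  have ints: "(\<integral>x. f x \<partial>lborel) = a * (\<integral>x. of_real (scaled h r x) * exp (\<i> * of_real (l \<bullet> x)) \<partial>lborel)"
    "(\<integral>x. g x \<partial>lborel) = a * (\<integral>x. of_real (scaled h r x) * exp (- \<i> * of_real (k \<bullet> x)) \<partial>lborel)"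
    unfolding f_def g_def by (rule integral_mult_right_zero)+
  show "(\<integral>\<omega>. scatter M \<eta> h r k \<omega> * cnj (scatter M \<eta> h r l \<omega>) \<partial>M) =
      of_real \<gamma> * correlation 0 (r *\<^sub>R (l - k)) +
      signed_integral (beta2 M \<eta>)
        (\<lambda>z. exp (- \<i> * of_real (k \<bullet> z)) * correlation (z /\<^sub>R r) (r *\<^sub>R (l - k))) +
      (of_real \<gamma> * (a * (\<integral>x. of_real (scaled h r x) * exp (\<i> * of_real (l \<bullet> x)) \<partial>lborel)) - c l) *
      (of_real \<gamma> * (a * (\<integral>x. of_real (scaled h r x) * exp (- \<i> * of_real (k \<bullet> x)) \<partial>lborel)) - c k)"
    unfolding eq covariance(2)[OF fg gC] G G0 ints ..
qed

end


text \<open>A limit in F is nonzero, so the centering is eventually absent and the definition of F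
  applies. The sign s covers both an amplitude and a conjugated one, matching the two conditions in
  F.\<close>

lemma (in taper) mean_term_tendsto_0:
  fixes \<kappa> :: "real \<Rightarrow> 'a" and \<gamma> :: real and s :: complex
  assumes \<kappa>: "\<kappa> \<in> wave_functions h \<union> zero_functions" and s: "s = \<i> \<or> s = - \<i>"
  shows "((\<lambda>r. of_real \<gamma> * (of_real (r powr (- (real DIM('a) / 2))) *
      (\<integral>x. of_real (scaled h r x) * exp (s * of_real (\<kappa> r \<bullet> x)) \<partial>lborel)) -
    of_bool (\<kappa> r = 0) * complex_of_real (taper_moment 1 h * \<gamma> * r powr (real DIM('a) / 2))) \<longlongrightarrow> 0) at_top"
    (is "(?T \<longlongrightarrow> 0) at_top")
  using \<kappa>
proof
  assume \<kappa>: "\<kappa> \<in> wave_functions h"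
  then obtain k where k: "k \<noteq> 0" "(\<kappa> \<longlongrightarrow> k) at_top"
    by (auto simp: wave_functions_def)
  have "((\<lambda>r. of_real \<gamma> * (of_real (r powr (- (real DIM('a) / 2))) *
      (\<integral>x. of_real (scaled h r x) * exp (s * of_real (\<kappa> r \<bullet> x)) \<partial>lborel))) \<longlongrightarrow> of_real \<gamma> * (0 :: complex)) at_top"
    using \<kappa> s by (intro tendsto_mult_left) (auto simp: wave_functions_def)
  moreover have "eventually (\<lambda>r. \<kappa> r \<noteq> 0) at_top"
    using tendsto_imp_eventually_ne[OF k(2,1)] .
  then have "eventually (\<lambda>r. of_real \<gamma> * (of_real (r powr (- (real DIM('a) / 2))) *
      (\<integral>x. of_real (scaled h r x) * exp (s * of_real (\<kappa> r \<bullet> x)) \<partial>lborel)) = ?T r) at_top"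
    by eventually_elim simp
  ultimately show ?thesis
    by (auto intro: Lim_transform_eventually)
next
  assume \<kappa>: "\<kappa> \<in> zero_functions"
  \<comment> \<open>At wave vector 0 the mean is gamma r^(-d/2) r^d M_1(h), so the centering cancels
    it exactly for each positive r.\<close>
  have zero: "?T r = 0" if r: "r > 0" for r
  proof -
    have "(\<integral>x. scaled h r x \<partial>lborel) = r ^ DIM('a) * taper_moment 1 h"
      using lborel_integral_affine[of "scaled h r" r 0] r
      by (simp add: scaled_def[abs_def] taper_moment_def)
    moreover have "r ^ DIM('a) = r powr (real DIM('a) / 2) * r powr (real DIM('a) / 2)"
      using r by (simp add: powr_realpow flip: powr_add)
    ultimately have "r powr (- (real DIM('a) / 2)) * (\<integral>x. scaled h r x \<partial>lborel) =
        r powr (real DIM('a) / 2) * taper_moment 1 h"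
      using r by (simp add: powr_minus)
    moreover have "\<kappa> r = 0"
      using \<kappa> r by (simp add: zero_functions_def)
    ultimately show ?thesis
      by (simp add: mult_ac flip: of_real_mult)
  qed
  show ?thesis
    by (rule tendsto_eventually, rule eventually_mono[OF eventually_gt_at_top[of 0]]) (rule zero)
qed

text \<open>Here \<kappa> and \<mu> are the functions (k_r) and (l_r). Since a Bochner integral is 0
  for a non-integrable function, the integrability clauses ensure that the limits concern genuine
  expectations.\<close>

theorem proposition3p4:
  fixes M :: "'w measure" and \<eta> :: "'w \<Rightarrow> 'a::euclidean_space set"
    and \<gamma> p :: real and h :: "'a \<Rightarrow> real"
    and \<kappa> \<mu> :: "real \<Rightarrow> 'a" and k l :: 'a
  assumes "point_process M \<eta>" and "stationary M \<eta>" and "locally_square_integrable M \<eta>"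
    and "intensity M \<eta> = ennreal \<gamma>" and "\<gamma> > 0"
    and "p > 0"
    and "(\<integral>\<^sup>+x. ennreal (1 + norm x powr p) \<partial>total_variation (beta2 M \<eta>)) < \<infinity>"
    and "h \<in> taper_class p"
    and "\<kappa> \<in> wave_functions h \<union> zero_functions" and "\<mu> \<in> wave_functions h \<union> zero_functions"
    and "(\<kappa> \<longlongrightarrow> k) at_top" and "(\<mu> \<longlongrightarrow> l) at_top"
  shows "(\<forall>r>0. integrable M (\<lambda>\<omega>. scatter M \<eta> h r (\<kappa> r) \<omega> * cnj (scatter M \<eta> h r (\<mu> r) \<omega>))) \<and>
    (k \<noteq> l \<longrightarrow>
      ((\<lambda>r. \<integral>\<omega>. scatter M \<eta> h r (\<kappa> r) \<omega> * cnj (scatter M \<eta> h r (\<mu> r) \<omega>) \<partial>M) \<longlongrightarrow> 0) at_top) \<and>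
    (\<forall>r>0. integrable M (\<lambda>\<omega>. (cmod (scatter M \<eta> h r (\<kappa> r) \<omega>))\<^sup>2)) \<and>
    ((\<lambda>r. complex_of_real (\<integral>\<omega>. (cmod (scatter M \<eta> h r (\<kappa> r) \<omega>))\<^sup>2 \<partial>M)) \<longlongrightarrow>
      complex_of_real (\<gamma> * taper_moment 2 h) * structure_factor M \<eta> k) at_top"
proof -
  interpret short_range_process M \<eta> \<gamma> p
    by unfold_locales (fact assms)+
  obtain C where C: "taper h C"
    using taper_class_imp_taper[OF \<open>h \<in> taper_class p\<close> \<open>p > 0\<close>] .
  interpret taper h C by (fact C)
  let ?G = "\<lambda>\<mu> r z. exp (- \<i> * of_real (\<kappa> r \<bullet> z)) * correlation (z /\<^sub>R r) (r *\<^sub>R (\<mu> r - \<kappa> r))"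
  have measG: "?G \<mu> r \<in> borel_measurable borel" for \<mu> r
    by (intro borel_measurable_times measurable_compose[OF _ measurable_correlation]) measurable
  have boundG: "norm (?G \<mu> r z) \<le> C * (\<integral>x. h x \<partial>lborel)" for \<mu> r z
    using norm_correlation_le[of "z /\<^sub>R r" "r *\<^sub>R (\<mu> r - \<kappa> r)"] by (simp add: norm_mult)
  \<comment> \<open>Both claims are instances: the correlations vanish in the limit when k and l
    differ, and tend to the second taper moment when \<mu> is \<kappa> itself.\<close>
  have limit: "((\<lambda>r. \<integral>\<omega>. scatter M \<eta> h r (\<kappa> r) \<omega> * cnj (scatter M \<eta> h r (\<mu> r) \<omega>) \<partial>M) \<longlongrightarrow>
      of_real \<gamma> * c + signed_integral (beta2 M \<eta>) g) at_top"
    if \<mu>: "\<mu> \<in> wave_functions h \<union> zero_functions"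
      and c: "((\<lambda>r. correlation 0 (r *\<^sub>R (\<mu> r - \<kappa> r))) \<longlongrightarrow> c) at_top"
      and g: "\<And>z. ((\<lambda>r. ?G \<mu> r z) \<longlongrightarrow> g z) at_top" "g \<in> borel_measurable borel" for \<mu> c g
  proof (rule Lim_transform_eventually)
    let ?m = "\<lambda>r. of_real \<gamma> * (of_real (r powr (- (real DIM('a) / 2))) *
        (\<integral>x. of_real (scaled h r x) * exp (\<i> * of_real (\<mu> r \<bullet> x)) \<partial>lborel)) -
      of_bool (\<mu> r = 0) * complex_of_real (taper_moment 1 h * \<gamma> * r powr (real DIM('a) / 2))"
    let ?k = "\<lambda>r. of_real \<gamma> * (of_real (r powr (- (real DIM('a) / 2))) *
        (\<integral>x. of_real (scaled h r x) * exp (- \<i> * of_real (\<kappa> r \<bullet> x)) \<partial>lborel)) -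
      of_bool (\<kappa> r = 0) * complex_of_real (taper_moment 1 h * \<gamma> * r powr (real DIM('a) / 2))"
    have "(?m \<longlongrightarrow> 0) at_top" "(?k \<longlongrightarrow> 0) at_top"
      by (rule mean_term_tendsto_0[OF \<mu>], simp) (rule mean_term_tendsto_0[OF assms(9)], simp)
    then have "((\<lambda>r. of_real \<gamma> * correlation 0 (r *\<^sub>R (\<mu> r - \<kappa> r)) +
        signed_integral (beta2 M \<eta>) (?G \<mu> r) + ?m r * ?k r) \<longlongrightarrow>
        of_real \<gamma> * c + signed_integral (beta2 M \<eta>) g + 0 * 0) at_top"
      by (intro tendsto_add tendsto_mult tendsto_const c
          signed_integral_tendsto[where B = "C * (\<integral>x. h x \<partial>lborel)"] measG g boundG)
    then show "((\<lambda>r. of_real \<gamma> * correlation 0 (r *\<^sub>R (\<mu> r - \<kappa> r)) +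
        signed_integral (beta2 M \<eta>) (?G \<mu> r) + ?m r * ?k r) \<longlongrightarrow>
        of_real \<gamma> * c + signed_integral (beta2 M \<eta>) g) at_top"
      by simp
    show "eventually (\<lambda>r. of_real \<gamma> * correlation 0 (r *\<^sub>R (\<mu> r - \<kappa> r)) +
        signed_integral (beta2 M \<eta>) (?G \<mu> r) + ?m r * ?k r =
        (\<integral>\<omega>. scatter M \<eta> h r (\<kappa> r) \<omega> * cnj (scatter M \<eta> h r (\<mu> r) \<omega>) \<partial>M)) at_top"
      using eventually_gt_at_top[of "0::real"]
      by eventually_elim (rule scatter_cross_moment(2)[OF C, symmetric])
  qed
  have int: "integrable M (\<lambda>\<omega>. scatter M \<eta> h r (\<kappa> r) \<omega> * cnj (scatter M \<eta> h r (\<mu> r) \<omega>))"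
    if "r > 0" for r \<mu>
    using that by (rule scatter_cross_moment(1)[OF C])
  have different: "((\<lambda>r. \<integral>\<omega>. scatter M \<eta> h r (\<kappa> r) \<omega> * cnj (scatter M \<eta> h r (\<mu> r) \<omega>) \<partial>M) \<longlongrightarrow> 0) at_top"
    if "k \<noteq> l"
  proof -
    \<comment> \<open>The frequency r(l_r - k_r) grows like r |l - k|, so distinct limits force it
      to infinity.\<close>
    have "((\<lambda>r. norm (\<mu> r - \<kappa> r)) \<longlongrightarrow> norm (l - k)) at_top"
      by (intro tendsto_norm tendsto_diff assms)
    then have "filterlim (\<lambda>r. norm (\<mu> r - \<kappa> r) * r) at_top at_top"
      by (rule filterlim_tendsto_pos_mult_at_top) (use that in \<open>auto simp: filterlim_ident\<close>)
    then have \<xi>: "filterlim (\<lambda>r. norm (r *\<^sub>R (\<mu> r - \<kappa> r))) at_top at_top"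
      by (rule filterlim_cong[OF refl refl, THEN iffD1, rotated])
        (use eventually_gt_at_top[of 0] in eventually_elim, simp)
    \<comment> \<open>The phase has modulus 1, so passing to norms leaves the correlation
      alone.\<close>
    have "((\<lambda>r. norm (?G \<mu> r z)) \<longlongrightarrow> 0) at_top" for z
      using tendsto_norm_zero[OF correlation_tendsto_0[OF \<xi>, of z]] by (simp add: norm_mult)
    then have "((\<lambda>r. ?G \<mu> r z) \<longlongrightarrow> 0) at_top" for z
      by (rule tendsto_norm_zero_cancel)
    moreover have "((\<lambda>r. correlation 0 (r *\<^sub>R (\<mu> r - \<kappa> r))) \<longlongrightarrow> 0) at_top"
      using correlation_tendsto_0[OF \<xi>, of 0] by simp
    ultimately show ?thesis
      using limit[OF assms(10), of 0 "\<lambda>_. 0"] by (simp add: signed_integral_def)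
  qed
  \<comment> \<open>For \<mu> = \<kappa> the frequency is identically 0: the phase converges with
    k_r, and the correlation tends to M_2(h).\<close>
  have "((\<lambda>r. ?G \<kappa> r z) \<longlongrightarrow> exp (- \<i> * of_real (k \<bullet> z)) * of_real (taper_moment 2 h)) at_top" for z
    using correlation_tendsto_moment[of z]
    by (simp, intro tendsto_intros assms(11))
  then have "((\<lambda>r. \<integral>\<omega>. scatter M \<eta> h r (\<kappa> r) \<omega> * cnj (scatter M \<eta> h r (\<kappa> r) \<omega>) \<partial>M) \<longlongrightarrow>
      of_real \<gamma> * of_real (taper_moment 2 h) +
      signed_integral (beta2 M \<eta>) (\<lambda>z. exp (- \<i> * of_real (k \<bullet> z)) * of_real (taper_moment 2 h))) at_top"
    by (intro limit assms(9)) (simp_all add: correlation_0_0)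
  \<comment> \<open>The constant M_2(h) leaves the signed integral, and the factor gamma cancels the
    division in the structure factor because gamma is positive.\<close>
  also have "of_real \<gamma> * of_real (taper_moment 2 h) +
      signed_integral (beta2 M \<eta>) (\<lambda>z. exp (- \<i> * of_real (k \<bullet> z)) * of_real (taper_moment 2 h)) =
      complex_of_real (\<gamma> * taper_moment 2 h) * structure_factor M \<eta> k"
    using gamma_pos by (simp add: structure_factor_def signed_integral_def intensity field_simps)
  finally have "((\<lambda>r. \<integral>\<omega>. scatter M \<eta> h r (\<kappa> r) \<omega> * cnj (scatter M \<eta> h r (\<kappa> r) \<omega>) \<partial>M) \<longlongrightarrow>
      complex_of_real (\<gamma> * taper_moment 2 h) * structure_factor M \<eta> k) at_top" .
  then have same: "((\<lambda>r. complex_of_real (\<integral>\<omega>. (cmod (scatter M \<eta> h r (\<kappa> r) \<omega>))\<^sup>2 \<partial>M)) \<longlongrightarrow>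
      complex_of_real (\<gamma> * taper_moment 2 h) * structure_factor M \<eta> k) at_top"
    by (simp only: complex_norm_square[symmetric] integral_complex_of_real)
  have "integrable M (\<lambda>\<omega>. (cmod (scatter M \<eta> h r (\<kappa> r) \<omega>))\<^sup>2)" if "r > 0" for r
    using int[OF that, of \<kappa>] by (simp only: complex_norm_square[symmetric] complex_of_real_integrable_eq)
  then show ?thesis
    using int different same by blast
qed

end
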